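(* Let $t\ge1$ be an integer. (1) There exist infinitely many real multiquadratic fields $L$ with $\mathrm{Gal}(L/\mathbb{Q})\cong(\mathbb{Z}/2\mathbb{Z})^{2t}$ containing $3t$ totally positive units that are independent modulo squares in $L$; in particular $\delta(L)\ge 3t$. (2) There exist infinitely many real multiquadratic fields $L$ with $\mathrm{Gal}(L/\mathbb{Q})\cong(\mathbb{Z}/2\mathbb{Z})^{3t}$ containing $7t$ totally positive units that are independent modulo squares in $L$; in particular $\delta(L)\ge 7t$.
   Context: For a totally real field $F$ of degree $n$ and $0\neq\alpha\in F$, the signature of $\alpha$ is the vector in $\mathbb{F}_2^n$ whose entry at a real embedding $v$ is $0$ if $v(\alpha)>0$ and $1$ if $v(\alpha)<0$. The signatures of the units of $F$ form a subspace of $\mathbb{F}_2^n$ whose dimension is the unit signature rank of $F$; the deficiency $\delta(F)$ is $n$ minus the unit signature rank, which equals the $\mathbb{F}_2$-rank of the group of totally positive units of $F$ modulo squares of units. *)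

theory Defs
  imports "HOL-Computational_Algebra.Polynomial" "HOL-Algebra.Group"
begin

text \<open>Number fields are modelled concretely as subfields of the reals.\<close>

definition real_subfield :: "real set \<Rightarrow> bool" where
  "real_subfield K \<longleftrightarrow> 0 \<in> K \<and> 1 \<in> K \<and>
     (\<forall>x\<in>K. \<forall>y\<in>K. x + y \<in> K \<and> x * y \<in> K) \<and>
     (\<forall>x\<in>K. - x \<in> K \<and> inverse x \<in> K)"

definition gen_subfield :: "real set \<Rightarrow> real set" where
  "gen_subfield S = \<Inter> {K. real_subfield K \<and> S \<subseteq> K}"

text \<open>A real multiquadratic field: generated over Q by square roots of finitely many
  positive rationals (hence a subfield of R, totally real and Galois over Q).\<close>
definition real_multiquadratic :: "real set \<Rightarrow> bool" where
  "real_multiquadratic L \<longleftrightarrow>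
     (\<exists>D :: rat set. finite D \<and> (\<forall>d\<in>D. d > 0) \<and>
        L = gen_subfield ((\<lambda>d. sqrt (of_rat d)) ` D))"

text \<open>Galois group Gal(L/Q): field automorphisms of L (they fix Q automatically),
  extended by the identity outside L, under composition.\<close>
definition gal :: "real set \<Rightarrow> (real \<Rightarrow> real) monoid" where
  "gal L = \<lparr> carrier = {\<sigma>. bij_betw \<sigma> L L \<and> \<sigma> 1 = 1 \<and>
       (\<forall>x\<in>L. \<forall>y\<in>L. \<sigma> (x + y) = \<sigma> x + \<sigma> y \<and> \<sigma> (x * y) = \<sigma> x * \<sigma> y) \<and>
       (\<forall>x. x \<notin> L \<longrightarrow> \<sigma> x = x)},
     mult = (\<circ>), one = id \<rparr>"

definition elem2_group :: "nat \<Rightarrow> (nat \<Rightarrow> bool) monoid" where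
  "elem2_group n = \<lparr> carrier = {f. \<forall>i\<ge>n. f i = False},
     mult = (\<lambda>f g i. f i \<noteq> g i), one = (\<lambda>_. False) \<rparr>"

definition real_embeddings :: "real set \<Rightarrow> (real \<Rightarrow> real) set" where
  "real_embeddings L = {\<sigma>. \<sigma> 1 = 1 \<and>
       (\<forall>x\<in>L. \<forall>y\<in>L. \<sigma> (x + y) = \<sigma> x + \<sigma> y \<and> \<sigma> (x * y) = \<sigma> x * \<sigma> y)}"

definition totally_positive :: "real set \<Rightarrow> real \<Rightarrow> bool" where
  "totally_positive L a \<longleftrightarrow> a \<in> L \<and> (\<forall>\<sigma>\<in>real_embeddings L. \<sigma> a > 0)"

definition is_unit_of :: "real set \<Rightarrow> real \<Rightarrow> bool" where
  "is_unit_of L u \<longleftrightarrow> u \<in> L \<and> u \<noteq> 0 \<and> algebraic_int u \<and> algebraic_int (inverse u)"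

definition indep_mod_squares :: "real set \<Rightarrow> (nat \<Rightarrow> real) \<Rightarrow> nat \<Rightarrow> bool" where
  "indep_mod_squares L u m \<longleftrightarrow>
     (\<forall>S. S \<subseteq> {..<m} \<and> S \<noteq> {} \<longrightarrow> \<not> (\<exists>y\<in>L. (\<Prod>i\<in>S. u i) = y ^ 2))"

end

theory Submission
  imports Defs "HOL-Computational_Algebra.Computational_Algebra" "HOL-Number_Theory.Number_Theory"
    "HOL-Analysis.Kronecker_Approximation_Theorem"
begin

text \<open>
An integer \<open>n > 1\<close> gives the totally positive unit \<open>\<epsilon> = 2n - 1 + 2 \<surd>(n(n - 1))\<close>, and
\<open>(1 + \<epsilon>)\<^sup>2 = 4n \<epsilon>\<close>, so \<open>\<epsilon>\<close> has the class of \<open>n\<close> modulo squares. By Kummer theory it suffices to find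
rational generators \<open>d\<close> of the field and integers \<open>n\<close>, with every \<open>n(n - 1)\<close> a product of some \<open>d\<close>s up to
squares, such that all \<open>d\<close> and \<open>n\<close> together are independent in \<open>\<rat>\<^sup>*\<close> modulo squares.

Take integers \<open>l\<^sub>1 > l\<^sub>2 > l\<^sub>3 > l\<^sub>4\<close> with \<open>l\<^sub>i - l\<^sub>j\<close> dividing \<open>l\<^sub>i\<close> for \<open>i < j\<close>. Then \<open>n = l\<^sub>i / (l\<^sub>i - l\<^sub>j)\<close>
has \<open>n(n - 1) \<equiv> l\<^sub>i l\<^sub>j\<close> modulo squares. Three of the \<open>l\<^sub>i\<close> give a biquadratic field with three units, all
four a triquadratic field with six. The seventh unit lives in \<open>\<rat>(\<surd>(l\<^sub>1 l\<^sub>2 l\<^sub>3 l\<^sub>4))\<close>: it is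
attached to the smallest solution \<open>a\<close> of Pell's equation, and congruences at suitable primes
\<open>p \<equiv> 3\<close> modulo 4 prevent the class of \<open>a\<close> from lying in the group generated by the others. All
congruences are imposed by the Chinese remainder theorem at primes as large as we like, so that
infinitely many such blocks are jointly independent.
\<close>

section \<open>Subfields generated by square roots\<close>

text \<open>The units coming from pairs \<open>l\<^sub>i\<close>, \<open>l\<^sub>j\<close> have
  explicit classes; the seventh has not. With D the class of
  \<open>l\<^sub>1 l\<^sub>2 l\<^sub>3 l\<^sub>4\<close>, all that is known of \<open>a\<close> is
  that \<open>a (a - 1) D\<close> is a square and that \<open>a\<close> is not one. As D is a
  product of six factors (atoms), a relation involving \<open>a\<close> leaves a subset J of them
  such that \<open>a\<close> times the product over J and \<open>a - 1\<close> times the product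
  over the complement are both squares. Every nonempty J has to be excluded without knowing
  \<open>a\<close>. A prime dividing exactly one factor, and that once, must divide \<open>a\<close>
  or \<open>a - 1\<close>, so the other one is known modulo it. If -1 were a residue,
  \<open>a\<close> and \<open>a - 1\<close> would play the same role, and the full set J, where
  \<open>a - 1\<close> is a square as in the negative Pell equation, would pass every test.
  Independence of different blocks is arranged separately: primes up to a bound N have even
  multiplicity in all entries of a block, so every nonempty product in it has a prime above N to an
  odd power, and N is at least every entry of the earlier blocks.\<close>

lemma real_subfield_gen: "real_subfield (gen_subfield S)"
  unfolding real_subfield_def gen_subfield_def by blast

lemma gen_subfield_incl: "S \<subseteq> gen_subfield S"
  unfolding gen_subfield_def by blast

lemma gen_subfield_least: "real_subfield K \<Longrightarrow> S \<subseteq> K \<Longrightarrow> gen_subfield S \<subseteq> K"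
  unfolding gen_subfield_def by blast

lemma subfield_0: "real_subfield K \<Longrightarrow> 0 \<in> K"
  and subfield_1: "real_subfield K \<Longrightarrow> 1 \<in> K"
  and subfield_add: "real_subfield K \<Longrightarrow> x \<in> K \<Longrightarrow> y \<in> K \<Longrightarrow> x + y \<in> K"
  and subfield_mult: "real_subfield K \<Longrightarrow> x \<in> K \<Longrightarrow> y \<in> K \<Longrightarrow> x * y \<in> K"
  and subfield_minus: "real_subfield K \<Longrightarrow> x \<in> K \<Longrightarrow> - x \<in> K"
  and subfield_inverse: "real_subfield K \<Longrightarrow> x \<in> K \<Longrightarrow> inverse x \<in> K"
  unfolding real_subfield_def by auto

lemma subfield_diff: "real_subfield K \<Longrightarrow> x \<in> K \<Longrightarrow> y \<in> K \<Longrightarrow> x - y \<in> K"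
  using subfield_add[of K x "- y"] subfield_minus[of K y] by simp

lemma subfield_divide: "real_subfield K \<Longrightarrow> x \<in> K \<Longrightarrow> y \<in> K \<Longrightarrow> x / y \<in> K"
  using subfield_mult[of K x "inverse y"] subfield_inverse[of K y] by (simp add: divide_inverse)

lemma subfield_power: "real_subfield K \<Longrightarrow> x \<in> K \<Longrightarrow> x ^ n \<in> K"
  by (induction n) (auto intro: subfield_1 subfield_mult)

lemma subfield_of_nat: "real_subfield K \<Longrightarrow> of_nat n \<in> K"
  by (induction n) (auto intro: subfield_0 subfield_1 subfield_add)

lemma subfield_of_int: "real_subfield K \<Longrightarrow> of_int n \<in> K"
  using subfield_of_nat[of K "nat n"] subfield_of_nat[of K "nat (- n)"]
    subfield_minus[of K "of_nat (nat (- n))"]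
  by (cases "n \<ge> 0") auto

lemma subfield_numeral: "real_subfield K \<Longrightarrow> numeral n \<in> K"
  using subfield_of_int[of K "numeral n"] by simp

lemma subfield_Rats: "real_subfield K \<Longrightarrow> x \<in> \<rat> \<Longrightarrow> x \<in> K"
  by (auto elim!: Rats_cases' intro: subfield_divide subfield_of_int)

lemma subfield_prod: "real_subfield K \<Longrightarrow> (\<And>i. i \<in> A \<Longrightarrow> f i \<in> K) \<Longrightarrow> prod f A \<in> K"
  by (induction A rule: infinite_finite_induct) (auto intro: subfield_1 subfield_mult)

lemmas subfield_intros = subfield_0 subfield_1 subfield_add subfield_mult subfield_minus
  subfield_inverse subfield_diff subfield_divide subfield_power subfield_of_int subfield_numeral
  subfield_prod

text \<open>Denominators are rationalised by the norm
  \<open>x\<^sup>2 - y\<^sup>2 * w\<^sup>2\<close>, which lies in \<open>K\<close> and is nonzero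
  for \<open>w\<close> outside \<open>K\<close> and x, y not both 0. If \<open>w\<close> lies in
  \<open>K\<close>, the set is \<open>K\<close> itself.\<close>

lemma subfield_quadratic:
  assumes K: "real_subfield K" and w: "w\<^sup>2 \<in> K"
  shows "real_subfield {x + y * w | x y. x \<in> K \<and> y \<in> K}" (is "real_subfield ?L")
proof (cases "w \<in> K")
  case True
  have "?L = K"
  proof
    show "?L \<subseteq> K" using True by (auto intro!: subfield_intros K)
    have "x = x + 0 * w" for x by simp
    then show "K \<subseteq> ?L" using subfield_0[OF K] by blast
  qed
  then show ?thesis using K by simp
next
  case False
  have inv: "inverse (x + y * w) \<in> ?L" if "x \<in> K" "y \<in> K" for x y
  proof (cases "x = 0 \<and> y = 0")
    case True
    then show ?thesis using subfield_0[OF K] by (auto intro!: exI[of _ 0])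
  next
    case nz: False
    have ne: "x - y * w \<noteq> 0"
    proof
      assume eq: "x - y * w = 0"
      with nz have "y \<noteq> 0" by auto
      with eq have "w = x / y" by (simp add: field_simps)
      with that False show False by (auto intro: subfield_intros K)
    qed
    define n where "n = x\<^sup>2 - y\<^sup>2 * w\<^sup>2"
    have n: "n \<in> K" unfolding n_def by (intro subfield_intros K that w)
    have n': "n = (x + y * w) * (x - y * w)" by (simp add: n_def algebra_simps power2_eq_square)
    have "inverse (x + y * w) = (x - y * w) / n" using ne by (simp add: n' divide_simps)
    also have "\<dots> = x / n + (- y / n) * w" by (simp add: diff_divide_distrib)
    finally have "inverse (x + y * w) = x / n + (- y / n) * w" .
    moreover have "x / n \<in> K" "- y / n \<in> K" by (intro subfield_intros K that n)+
    ultimately show ?thesis by blast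
  qed
  have add: "(x + y * w) + (x' + y' * w) \<in> ?L" if "x \<in> K" "y \<in> K" "x' \<in> K" "y' \<in> K" for x y x' y'
  proof -
    have "(x + y * w) + (x' + y' * w) = (x + x') + (y + y') * w" by (simp add: algebra_simps)
    moreover have "x + x' \<in> K" "y + y' \<in> K" by (intro subfield_intros K that)+
    ultimately show ?thesis by blast
  qed
  have mult: "(x + y * w) * (x' + y' * w) \<in> ?L" if "x \<in> K" "y \<in> K" "x' \<in> K" "y' \<in> K" for x y x' y'
  proof -
    have "(x + y * w) * (x' + y' * w) = (x * x' + y * y' * w\<^sup>2) + (x * y' + y * x') * w"
      by (simp add: algebra_simps power2_eq_square)
    moreover have "x * x' + y * y' * w\<^sup>2 \<in> K" "x * y' + y * x' \<in> K"
      by (intro subfield_intros K that w)+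
    ultimately show ?thesis by blast
  qed
  have minus: "- (x + y * w) \<in> ?L" if "x \<in> K" "y \<in> K" for x y
  proof -
    have "- (x + y * w) = - x + (- y) * w" by simp
    moreover have "- x \<in> K" "- y \<in> K" by (intro subfield_intros K that)+
    ultimately show ?thesis by blast
  qed
  have "0 = 0 + 0 * w" "1 = 1 + 0 * w" by simp_all
  then have "0 \<in> ?L" "1 \<in> ?L"
    using subfield_0[OF K] subfield_1[OF K] by blast+
  moreover have "a + b \<in> ?L \<and> a * b \<in> ?L" if "a \<in> ?L" "b \<in> ?L" for a b
    using that add mult by (elim CollectE exE conjE) simp
  moreover have "- a \<in> ?L \<and> inverse a \<in> ?L" if "a \<in> ?L" for a
    using that minus inv by (elim CollectE exE conjE) simp
  ultimately show ?thesis
    unfolding real_subfield_def by simp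
qed

lemma gen_subfield_insert:
  assumes w: "w\<^sup>2 \<in> gen_subfield S"
  shows "gen_subfield (insert w S) = {x + y * w | x y. x \<in> gen_subfield S \<and> y \<in> gen_subfield S}"
    (is "_ = ?L")
proof
  note sf = real_subfield_gen[of S]
  show "gen_subfield (insert w S) \<subseteq> ?L"
  proof (rule gen_subfield_least)
    show "real_subfield ?L" by (rule subfield_quadratic[OF sf w])
    have "w = 0 + 1 * w" by simp
    then have "w \<in> ?L" using subfield_0[OF sf] subfield_1[OF sf] by blast
    moreover have "x \<in> ?L" if "x \<in> S" for x
    proof -
      have "x = x + 0 * w" by simp
      then show ?thesis using subfield_0[OF sf] that gen_subfield_incl[of S] by blast
    qed
    ultimately show "insert w S \<subseteq> ?L" by auto
  qed
  have sub: "gen_subfield S \<subseteq> gen_subfield (insert w S)"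
    using gen_subfield_incl[of "insert w S"] by (intro gen_subfield_least real_subfield_gen) auto
  have "w \<in> gen_subfield (insert w S)"
    using gen_subfield_incl by blast
  then show "?L \<subseteq> gen_subfield (insert w S)"
    using sub by (auto intro!: subfield_add[OF real_subfield_gen] subfield_mult[OF real_subfield_gen])
qed

definition sqrt_field :: "(nat \<Rightarrow> int) \<Rightarrow> nat set \<Rightarrow> real set" where
  "sqrt_field d I = gen_subfield ((\<lambda>i. sqrt (of_int (d i))) ` I)"

lemma real_subfield_sqrt_field: "real_subfield (sqrt_field d I)"
  by (simp add: sqrt_field_def real_subfield_gen)

lemma sqrt_in_sqrt_field: "i \<in> I \<Longrightarrow> sqrt (of_int (d i)) \<in> sqrt_field d I"
  unfolding sqrt_field_def by (rule subsetD[OF gen_subfield_incl]) simp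

lemma sqrt_field_empty: "sqrt_field d {} = \<rat>"
proof
  have "real_subfield \<rat>" by (auto simp: real_subfield_def)
  then show "sqrt_field d {} \<subseteq> \<rat>" unfolding sqrt_field_def by (intro gen_subfield_least) auto
  show "\<rat> \<subseteq> sqrt_field d {}" using subfield_Rats[OF real_subfield_sqrt_field] by blast
qed

lemma sqrt_field_insert:
  assumes "d i \<ge> 0"
  shows "sqrt_field d (insert i I) =
    {x + y * sqrt (of_int (d i)) | x y. x \<in> sqrt_field d I \<and> y \<in> sqrt_field d I}"
  unfolding sqrt_field_def image_insert
  by (rule gen_subfield_insert) (use assms subfield_of_int[OF real_subfield_gen] in simp)

text \<open>The half of Kummer theory that is used. Write sqrt(c) = x + y w over the smaller field:
  squaring leaves the cross term 2 x y w, so either \<open>w\<close> is already there or one of x, y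
  vanishes. If x vanishes, \<open>c * d i\<close> replaces \<open>c\<close> and \<open>i\<close>
  joins \<open>B\<close>.\<close>

lemma sqrt_in_sqrt_field_imp:
  assumes "finite I" "\<And>i. i \<in> I \<Longrightarrow> d i > 0" "c > 0" "sqrt (of_int c) \<in> sqrt_field d I"
  shows "\<exists>B\<subseteq>I. sqrt (of_int (c * prod d B)) \<in> \<rat>"
  using assms
proof (induction I arbitrary: c rule: finite_induct)
  case empty
  then show ?case by (auto simp: sqrt_field_empty)
next
  case (insert i I)
  define w where "w = sqrt (of_int (d i))"
  define K where "K = sqrt_field d I"
  note sf = real_subfield_sqrt_field[of d I, folded K_def]
  have w2: "w\<^sup>2 = of_int (d i)" using insert.prems(1)[of i] by (simp add: w_def)
  obtain x y where xy: "sqrt (of_int c) = x + y * w" "x \<in> K" "y \<in> K"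
    using insert.prems sqrt_field_insert[of d i I] unfolding w_def K_def by force
  have IH: "\<exists>B\<subseteq>I. sqrt (of_int (c' * prod d B)) \<in> \<rat>" if "c' > 0" "sqrt (of_int c') \<in> K" for c'
    using insert.IH[of c'] insert.prems that by (auto simp: K_def)
  consider "w \<in> K" | "x = 0" "w \<notin> K" | "y = 0" "w \<notin> K" | "x \<noteq> 0" "y \<noteq> 0" "w \<notin> K" by blast
  then show ?case
  proof cases
    case 1
    then have "sqrt (of_int c) \<in> K" using xy by (auto intro: subfield_intros sf)
    then show ?thesis using IH[of c] insert.prems by blast
  next
    case 3
    then show ?thesis using IH[of c] xy insert.prems by auto
  next
    case 2
    have "sqrt (of_int (c * d i)) = y * (w * w)"
      using xy 2 by (simp add: real_sqrt_mult w_def)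
    also have "\<dots> = y * of_int (d i)" using w2 by (simp add: power2_eq_square)
    finally have "sqrt (of_int (c * d i)) \<in> K" using xy by (auto intro: subfield_intros sf)
    with IH[of "c * d i"] insert.prems obtain B where
      B: "B \<subseteq> I" "sqrt (of_int (c * d i * prod d B)) \<in> \<rat>" by auto
    have "prod d (insert i B) = d i * prod d B"
      using B insert.hyps finite_subset by (subst prod.insert) auto
    then show ?thesis using B by (intro exI[of _ "insert i B"]) (auto simp: mult_ac)
  next
    case 4
    have "of_int c = (x + y * w)\<^sup>2" using insert.prems by (simp flip: xy(1))
    also have "\<dots> = x\<^sup>2 + y\<^sup>2 * of_int (d i) + 2 * x * y * w"
      by (simp add: power2_sum power_mult_distrib w2)
    finally have "w = (of_int c - x\<^sup>2 - y\<^sup>2 * of_int (d i)) / (2 * x * y)"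
      using 4 by (simp add: field_simps)
    also have "\<dots> \<in> K" by (intro subfield_intros sf xy)
    finally show ?thesis using 4 by simp
  qed
qed

lemma int_square_if_sqrt_Rats:
  assumes "sqrt (of_int c) \<in> \<rat>" "c \<ge> 0"
  shows "\<exists>w::int. c = w\<^sup>2"
proof -
  have "(\<exists>k. real_of_int c = real_of_int k ^ 2)"
  proof -
    obtain q where q: "sqrt (of_int c) = of_rat q" using assms by (auto elim: Rats_cases)
    have "(of_rat (q^2)::real) = of_rat (of_int c)"
      using assms(2) by (simp add: of_rat_power flip: q)
    then have qc: "q ^ 2 = of_int c" by (simp only: of_rat_eq_iff)
    obtain a b where ab: "q = Rat.Fract a b" "b > 0" "coprime a b" by (cases q) auto
    have "q * of_int b = of_int a" using ab by (simp add: Fract_of_int_quotient)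
    then have "(of_int (c * b^2) :: rat) = of_int (a^2)"
      by (simp add: power_mult_distrib flip: qc) (simp flip: power_mult_distrib)
    then have "c * b^2 = a^2" by (simp only: of_int_eq_iff)
    then have "b dvd a\<^sup>2" by (metis dvd_triv_right power2_eq_square dvd_mult_right)
    moreover have "coprime (a\<^sup>2) b" using ab(3) by simp
    ultimately have "b = 1" using ab(2)
      by (metis coprime_absorb_right coprime_commute zdvd1_eq abs_of_pos)
    then have "c = a\<^sup>2" using \<open>c * b^2 = a^2\<close> by simp
    then show ?thesis by auto
  qed
  then show ?thesis by (metis of_int_eq_iff of_int_power)
qed

section \<open>Automorphisms of multiquadratic fields\<close>

text \<open>The condition common to \<open>gal\<close> and \<open>real_embeddings\<close>. Values
  outside \<open>K\<close> are unconstrained and values on \<open>K\<close> need not lie in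
  \<open>K\<close>, so the facts below serve both.\<close>

definition field_hom :: "real set \<Rightarrow> (real \<Rightarrow> real) \<Rightarrow> bool" where
  "field_hom K \<sigma> \<longleftrightarrow> \<sigma> 1 = 1 \<and>
     (\<forall>x\<in>K. \<forall>y\<in>K. \<sigma> (x + y) = \<sigma> x + \<sigma> y \<and> \<sigma> (x * y) = \<sigma> x * \<sigma> y)"

lemma field_hom_add: "field_hom K \<sigma> \<Longrightarrow> x \<in> K \<Longrightarrow> y \<in> K \<Longrightarrow> \<sigma> (x + y) = \<sigma> x + \<sigma> y"
  and field_hom_mult: "field_hom K \<sigma> \<Longrightarrow> x \<in> K \<Longrightarrow> y \<in> K \<Longrightarrow> \<sigma> (x * y) = \<sigma> x * \<sigma> y"
  and field_hom_1: "field_hom K \<sigma> \<Longrightarrow> \<sigma> 1 = 1"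
  by (auto simp: field_hom_def)

lemma field_hom_0: "field_hom K \<sigma> \<Longrightarrow> real_subfield K \<Longrightarrow> \<sigma> 0 = 0"
  using field_hom_add[of K \<sigma> 0 0] subfield_0[of K] by simp

lemma field_hom_minus:
  assumes "field_hom K \<sigma>" "real_subfield K" "x \<in> K"
  shows "\<sigma> (- x) = - \<sigma> x"
  using field_hom_add[of K \<sigma> x "- x"] field_hom_0[of K \<sigma>] subfield_minus[of K x] assms by simp

lemma field_hom_inverse:
  assumes h: "field_hom K \<sigma>" and K: "real_subfield K" and x: "x \<in> K"
  shows "\<sigma> (inverse x) = inverse (\<sigma> x)"
proof (cases "x = 0")
  case True
  then show ?thesis using field_hom_0[OF h K] by simp
next
  case False
  then have "\<sigma> x * \<sigma> (inverse x) = 1"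
    using field_hom_mult[OF h x subfield_inverse[OF K x]] field_hom_1[OF h] by simp
  then show ?thesis by (simp add: inverse_unique)
qed

lemma field_hom_of_nat: "field_hom K \<sigma> \<Longrightarrow> real_subfield K \<Longrightarrow> \<sigma> (of_nat n) = of_nat n"
  by (induction n) (simp_all add: field_hom_0 field_hom_1 field_hom_add subfield_1 subfield_of_nat)

lemma field_hom_of_int:
  assumes "field_hom K \<sigma>" "real_subfield K"
  shows "\<sigma> (of_int n) = of_int n"
  using field_hom_of_nat[OF assms, of "nat n"] field_hom_of_nat[OF assms, of "nat (- n)"]
    field_hom_minus[OF assms subfield_of_nat[OF assms(2), of "nat (- n)"]]
  by (cases "n \<ge> 0") auto

lemma field_hom_sqrt_cases:
  assumes h: "field_hom K \<sigma>" and K: "real_subfield K" and c: "c \<ge> 0" "sqrt (of_int c) \<in> K"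
  shows "\<sigma> (sqrt (of_int c)) = sqrt (of_int c) \<or> \<sigma> (sqrt (of_int c)) = - sqrt (of_int c)"
proof -
  have "\<sigma> (sqrt (of_int c)) * \<sigma> (sqrt (of_int c)) = of_int c"
    using field_hom_mult[OF h c(2) c(2)] c(1) field_hom_of_int[OF h K] by simp
  also have "\<dots> = sqrt (of_int c) * sqrt (of_int c)" using c(1) by simp
  finally show ?thesis by (simp only: square_eq_iff)
qed

lemma subfield_equalizer:
  assumes "field_hom K \<sigma>" "field_hom K \<tau>" "real_subfield K"
  shows "real_subfield {x \<in> K. \<sigma> x = \<tau> x}"
  unfolding real_subfield_def
  using assms by (auto simp: field_hom_0 field_hom_1 field_hom_add field_hom_mult field_hom_minus
      field_hom_inverse intro: subfield_intros)

lemma field_hom_eqI: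
  assumes h: "field_hom (sqrt_field d I) \<sigma>" "field_hom (sqrt_field d I) \<tau>"
    and eq: "\<And>i. i \<in> I \<Longrightarrow> \<sigma> (sqrt (of_int (d i))) = \<tau> (sqrt (of_int (d i)))"
    and x: "x \<in> sqrt_field d I"
  shows "\<sigma> x = \<tau> x"
proof -
  have "sqrt_field d I \<subseteq> {x \<in> sqrt_field d I. \<sigma> x = \<tau> x}"
    by (subst (1) sqrt_field_def, rule gen_subfield_least[OF subfield_equalizer[OF h real_subfield_sqrt_field]])
      (auto simp: eq sqrt_in_sqrt_field)
  with x show ?thesis by blast
qed

lemma field_hom_comp:
  assumes "field_hom K \<sigma>" "field_hom K \<tau>" "\<And>x. x \<in> K \<Longrightarrow> \<tau> x \<in> K"
  shows "field_hom K (\<sigma> \<circ> \<tau>)"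
  using assms by (simp add: field_hom_def)

text \<open>A homomorphism is extended across one quadratic step at a time, sending x + y w to
  \<sigma> x plus or minus \<sigma> y w. As \<open>w\<close> is not in the smaller field, x and y
  are determined by x + y w; this is where the independence of the radicands enters.\<close>

lemma ex_field_hom_signs:
  fixes d :: "nat \<Rightarrow> int" and f :: "nat \<Rightarrow> bool"
  assumes "\<And>i. i < n \<Longrightarrow> d i > 0" "\<And>i. i < n \<Longrightarrow> sqrt (of_int (d i)) \<notin> sqrt_field d {..<i}"
  shows "\<exists>\<sigma>. field_hom (sqrt_field d {..<n}) \<sigma> \<and> \<sigma> ` sqrt_field d {..<n} \<subseteq> sqrt_field d {..<n} \<and>
    (\<forall>i<n. \<sigma> (sqrt (of_int (d i))) = (if f i then - sqrt (of_int (d i)) else sqrt (of_int (d i))))"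
  using assms
proof (induction n)
  case 0
  show ?case by (intro exI[of _ id]) (auto simp: field_hom_def)
next
  case (Suc n)
  define w where "w = sqrt (of_int (d n))"
  define K where "K = sqrt_field d {..<n}"
  define L where "L = sqrt_field d {..<Suc n}"
  have sf: "real_subfield K" "real_subfield L"
    by (simp_all add: K_def L_def real_subfield_sqrt_field)
  have L: "L = {x + y * w | x y. x \<in> K \<and> y \<in> K}"
    using sqrt_field_insert[of d n "{..<n}"] Suc.prems(1)[of n]
    by (simp add: L_def K_def w_def lessThan_Suc)
  have w: "w \<notin> K" using Suc.prems(2)[of n] by (simp add: w_def K_def)
  have w2: "w * w = of_int (d n)" using Suc.prems(1)[of n] by (simp add: w_def)
  obtain \<sigma> where \<sigma>: "field_hom K \<sigma>" "\<sigma> ` K \<subseteq> K"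
    "\<And>i. i < n \<Longrightarrow> \<sigma> (sqrt (of_int (d i))) = (if f i then - sqrt (of_int (d i)) else sqrt (of_int (d i)))"
    using Suc by (auto simp: K_def)
  have \<sigma>K: "\<sigma> x \<in> K" if "x \<in> K" for x using \<sigma>(2) that by blast
  define e where "e = (if f n then - 1 else 1 :: real)"
  have e: "e * e = 1" "e \<in> K" by (auto simp: e_def intro: subfield_intros sf)
  have uniq: "x = x' \<and> y = y'" if "x + y * w = x' + y' * w" "x \<in> K" "y \<in> K" "x' \<in> K" "y' \<in> K" for x y x' y'
  proof -
    have "y = y'"
    proof (rule ccontr)
      assume "y \<noteq> y'"
      then have "w = (x' - x) / (y - y')" using that(1) by (simp add: field_simps)
      also have "\<dots> \<in> K" by (intro subfield_intros sf that)
      finally show False using w by simp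
    qed
    then show ?thesis using that(1) by simp
  qed
  define c where "c v = (SOME p. fst p \<in> K \<and> snd p \<in> K \<and> v = fst p + snd p * w)" for v
  have c: "c (x + y * w) = (x, y)" if "x \<in> K" "y \<in> K" for x y
    unfolding c_def
  proof (rule some_equality)
    fix p assume "fst p \<in> K \<and> snd p \<in> K \<and> x + y * w = fst p + snd p * w"
    then have "x = fst p \<and> y = snd p" using uniq[of x y "fst p" "snd p"] that by blast
    then show "p = (x, y)" by simp
  qed (use that in simp)
  define \<tau> where "\<tau> v = \<sigma> (fst (c v)) + e * \<sigma> (snd (c v)) * w" for v
  have \<tau>: "\<tau> (x + y * w) = \<sigma> x + e * \<sigma> y * w" if "x \<in> K" "y \<in> K" for x y
    using c[OF that] by (simp add: \<tau>_def)
  have \<tau>_K: "\<tau> x = \<sigma> x" if "x \<in> K" for x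
    using \<tau>[OF that subfield_0[OF sf(1)]] field_hom_0[OF \<sigma>(1) sf(1)] by simp
  have \<tau>_w: "\<tau> w = e * w"
    using \<tau>[OF subfield_0[OF sf(1)] subfield_1[OF sf(1)]] field_hom_0[OF \<sigma>(1) sf(1)]
      field_hom_1[OF \<sigma>(1)] by simp
  note hom = field_hom_add[OF \<sigma>(1)] field_hom_mult[OF \<sigma>(1)] field_hom_of_int[OF \<sigma>(1) sf(1)]
  have add: "\<tau> ((x + y * w) + (x' + y' * w)) = \<tau> (x + y * w) + \<tau> (x' + y' * w)"
    if "x \<in> K" "y \<in> K" "x' \<in> K" "y' \<in> K" for x y x' y'
  proof -
    have eq: "(x + y * w) + (x' + y' * w) = (x + x') + (y + y') * w" by (simp add: algebra_simps)
    have "\<tau> ((x + y * w) + (x' + y' * w)) = \<sigma> (x + x') + e * \<sigma> (y + y') * w"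
      unfolding eq by (intro \<tau> subfield_intros sf that)
    also have "\<dots> = (\<sigma> x + e * \<sigma> y * w) + (\<sigma> x' + e * \<sigma> y' * w)"
      using that by (simp add: hom algebra_simps)
    finally show ?thesis using that by (simp add: \<tau>)
  qed
  have mult: "\<tau> ((x + y * w) * (x' + y' * w)) = \<tau> (x + y * w) * \<tau> (x' + y' * w)"
    if "x \<in> K" "y \<in> K" "x' \<in> K" "y' \<in> K" for x y x' y'
  proof -
    let ?a = "x * x' + y * y' * of_int (d n)" and ?b = "x * y' + y * x'"
    have K: "?a \<in> K" "?b \<in> K" "y * y' \<in> K" "x * x' \<in> K" "x * y' \<in> K" "y * x' \<in> K"
      "y * y' * of_int (d n) \<in> K" "of_int (d n) \<in> K"
      by (intro subfield_intros sf that)+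
    have "(x + y * w) * (x' + y' * w) = x * x' + y * y' * (w * w) + (x * y' + y * x') * w"
      by (simp add: algebra_simps)
    then have eq: "(x + y * w) * (x' + y' * w) = ?a + ?b * w" by (simp only: w2)
    have "\<tau> ((x + y * w) * (x' + y' * w)) = \<sigma> ?a + e * \<sigma> ?b * w"
      unfolding eq by (rule \<tau>[OF K(1,2)])
    also have "\<dots> = \<sigma> x * \<sigma> x' + \<sigma> y * \<sigma> y' * (w * w) + e * (\<sigma> x * \<sigma> y' + \<sigma> y * \<sigma> x') * w"
      using that K by (simp add: hom w2)
    also have "\<dots> = \<sigma> x * \<sigma> x' + (e * e) * \<sigma> y * \<sigma> y' * (w * w) + e * (\<sigma> x * \<sigma> y' + \<sigma> y * \<sigma> x') * w"
      by (simp add: e)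
    also have "\<dots> = (\<sigma> x + e * \<sigma> y * w) * (\<sigma> x' + e * \<sigma> y' * w)"
      by (simp add: algebra_simps)
    finally show ?thesis using that by (simp add: \<tau>)
  qed
  have "field_hom L \<tau>"
    unfolding field_hom_def
  proof (intro conjI ballI)
    show "\<tau> 1 = 1" using \<tau>_K[OF subfield_1[OF sf(1)]] field_hom_1[OF \<sigma>(1)] by simp
    fix a b assume "a \<in> L" "b \<in> L"
    then obtain x y x' y' where "a = x + y * w" "b = x' + y' * w"
      "x \<in> K" "y \<in> K" "x' \<in> K" "y' \<in> K" unfolding L by blast
    then show "\<tau> (a + b) = \<tau> a + \<tau> b" "\<tau> (a * b) = \<tau> a * \<tau> b" using add mult by simp_all
  qed
  moreover have "\<tau> ` L \<subseteq> L"
  proof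
    fix v assume "v \<in> \<tau> ` L"
    then obtain x y where "v = \<tau> (x + y * w)" "x \<in> K" "y \<in> K" unfolding L by blast
    then have "v = \<sigma> x + (e * \<sigma> y) * w" "\<sigma> x \<in> K" "e * \<sigma> y \<in> K"
      by (simp_all add: \<tau> \<sigma>K subfield_mult[OF sf(1)] e)
    then show "v \<in> L" unfolding L by blast
  qed
  moreover have "\<tau> (sqrt (of_int (d i))) = (if f i then - sqrt (of_int (d i)) else sqrt (of_int (d i)))"
    if "i < Suc n" for i
  proof (cases "i = n")
    case True
    then show ?thesis using \<tau>_w by (simp add: w_def e_def)
  next
    case False
    then have "i < n" using that by simp
    then show ?thesis using \<tau>_K[of "sqrt (of_int (d i))"] \<sigma>(3)[of i] sqrt_in_sqrt_field[of i "{..<n}" d]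
      by (simp add: K_def)
  qed
  ultimately show ?case unfolding L_def by blast
qed

lemma gal_carrierD:
  assumes "\<sigma> \<in> carrier (gal L)"
  shows "field_hom L \<sigma>" "\<And>x. x \<in> L \<Longrightarrow> \<sigma> x \<in> L" "\<And>x. x \<notin> L \<Longrightarrow> \<sigma> x = x"
  using assms by (auto simp: gal_def field_hom_def bij_betw_def)

text \<open>An automorphism is determined by the set of roots that it negates, every set occurs, and
  composition becomes symmetric difference.\<close>

theorem gal_sqrt_field:
  fixes d :: "nat \<Rightarrow> int"
  assumes d: "\<And>i. i < n \<Longrightarrow> d i > 0"
    and indep: "\<And>i. i < n \<Longrightarrow> sqrt (of_int (d i)) \<notin> sqrt_field d {..<i}"
  shows "gal (sqrt_field d {..<n}) \<cong> elem2_group n"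
proof -
  define L where "L = sqrt_field d {..<n}"
  define w where "w i = sqrt (of_int (d i))" for i
  have sf: "real_subfield L" by (simp add: L_def real_subfield_sqrt_field)
  have w: "w i \<in> L" "w i \<noteq> 0" if "i < n" for i
    using that d[OF that] by (auto simp: w_def L_def sqrt_in_sqrt_field)
  define \<phi> where "\<phi> \<sigma> = (\<lambda>i. i < n \<and> \<sigma> (w i) \<noteq> w i)" for \<sigma> :: "real \<Rightarrow> real"
  have sgn: "\<sigma> (w i) = (if \<phi> \<sigma> i then - w i else w i)" if "\<sigma> \<in> carrier (gal L)" "i < n" for \<sigma> i
    using field_hom_sqrt_cases[OF gal_carrierD(1)[OF that(1)] sf, of "d i"] w[OF that(2)] d[OF that(2)] that(2)
    by (auto simp: \<phi>_def w_def)
  have eqI: "\<sigma> x = \<tau> x" if "field_hom L \<sigma>" "field_hom L \<tau>" "\<And>i. i < n \<Longrightarrow> \<sigma> (w i) = \<tau> (w i)" "x \<in> L" for \<sigma> \<tau> x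
    using field_hom_eqI[of d "{..<n}" \<sigma> \<tau> x] that by (simp add: L_def w_def)
  have "\<phi> \<in> hom (gal L) (elem2_group n)"
  proof (rule homI)
    fix \<sigma> \<tau> assume st: "\<sigma> \<in> carrier (gal L)" "\<tau> \<in> carrier (gal L)"
    show "\<phi> \<sigma> \<in> carrier (elem2_group n)" by (simp add: \<phi>_def elem2_group_def)
    have "\<phi> (\<sigma> \<circ> \<tau>) i = (\<phi> \<sigma> i \<noteq> \<phi> \<tau> i)" for i
    proof (cases "i < n")
      case True
      have "\<sigma> (- w i) = - \<sigma> (w i)"
        by (rule field_hom_minus[OF gal_carrierD(1)[OF st(1)] sf w(1)[OF True]])
      then have "\<sigma> (\<tau> (w i)) = (if \<phi> \<tau> i then - \<sigma> (w i) else \<sigma> (w i))"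
        using sgn[OF st(2) True] by simp
      then have "\<sigma> (\<tau> (w i)) = (if \<phi> \<sigma> i \<noteq> \<phi> \<tau> i then - w i else w i)"
        using sgn[OF st(1) True] by auto
      then show ?thesis using True w(2)[OF True] by (simp add: \<phi>_def[of "\<sigma> \<circ> \<tau>"])
    qed (simp add: \<phi>_def)
    then show "\<phi> (\<sigma> \<otimes>\<^bsub>gal L\<^esub> \<tau>) = \<phi> \<sigma> \<otimes>\<^bsub>elem2_group n\<^esub> \<phi> \<tau>"
      by (simp add: gal_def elem2_group_def fun_eq_iff)
  qed
  moreover have "bij_betw \<phi> (carrier (gal L)) (carrier (elem2_group n))"
    unfolding bij_betw_def
  proof
    show "inj_on \<phi> (carrier (gal L))"
    proof
      fix \<sigma> \<tau> assume st: "\<sigma> \<in> carrier (gal L)" "\<tau> \<in> carrier (gal L)" "\<phi> \<sigma> = \<phi> \<tau>"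
      have "\<sigma> x = \<tau> x" for x
        using eqI[of \<sigma> \<tau> x] sgn[OF st(1)] sgn[OF st(2)] st(3) gal_carrierD[OF st(1)] gal_carrierD[OF st(2)]
        by (cases "x \<in> L") auto
      then show "\<sigma> = \<tau>" by blast
    qed
    show "\<phi> ` carrier (gal L) = carrier (elem2_group n)"
    proof (intro equalityI subsetI)
      fix f assume "f \<in> \<phi> ` carrier (gal L)"
      then show "f \<in> carrier (elem2_group n)" by (auto simp: \<phi>_def elem2_group_def)
    next
      fix f assume "f \<in> carrier (elem2_group n)"
      then have f: "\<not> f i" if "i \<ge> n" for i using that by (simp add: elem2_group_def)
      obtain \<sigma> where \<sigma>: "field_hom L \<sigma>" "\<sigma> ` L \<subseteq> L"
        "\<And>i. i < n \<Longrightarrow> \<sigma> (w i) = (if f i then - w i else w i)"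
        using ex_field_hom_signs[OF d indep, of n f] by (auto simp: L_def w_def)
      have \<sigma>L: "\<sigma> x \<in> L" if "x \<in> L" for x using \<sigma>(2) that by blast
      \<comment> \<open>Sign changes are involutions: \<sigma> composed with itself fixes every
        root, hence all of \<open>L\<close>. Bijectivity follows with \<sigma> as its own
        inverse.\<close>
      have inv: "\<sigma> (\<sigma> x) = x" if "x \<in> L" for x
      proof -
        have "(\<sigma> \<circ> \<sigma>) x = id x"
        proof (rule eqI[OF field_hom_comp[OF \<sigma>(1) \<sigma>(1) \<sigma>L] _ _ that])
          show "field_hom L id" by (simp add: field_hom_def)
          show "(\<sigma> \<circ> \<sigma>) (w i) = id (w i)" if "i < n" for i
            using \<sigma>(3)[OF that] field_hom_minus[OF \<sigma>(1) sf w(1)[OF that]] by simp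
        qed
        then show ?thesis by simp
      qed
      define \<tau> where "\<tau> x = (if x \<in> L then \<sigma> x else x)" for x
      have "bij_betw \<tau> L L"
        by (rule bij_betwI[where g = \<tau>]) (auto simp: \<tau>_def \<sigma>L inv)
      moreover have "\<tau> 1 = 1" using subfield_1[OF sf] field_hom_1[OF \<sigma>(1)] by (simp add: \<tau>_def)
      moreover have "\<tau> (x + y) = \<tau> x + \<tau> y \<and> \<tau> (x * y) = \<tau> x * \<tau> y" if "x \<in> L" "y \<in> L" for x y
        using that subfield_add[OF sf] subfield_mult[OF sf] \<sigma>(1)
        by (simp add: \<tau>_def field_hom_add field_hom_mult)
      ultimately have "\<tau> \<in> carrier (gal L)" by (simp add: gal_def \<tau>_def)
      moreover have "\<phi> \<tau> = f"
      proof
        fix i show "\<phi> \<tau> i = f i"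
          using \<sigma>(3)[of i] w[of i] f[of i] by (cases "i < n") (auto simp: \<phi>_def \<tau>_def)
      qed
      ultimately show "f \<in> \<phi> ` carrier (gal L)" by blast
    qed
  qed
  ultimately have "\<phi> \<in> iso (gal L) (elem2_group n)" by (simp add: iso_def)
  then show ?thesis unfolding is_iso_def L_def by blast
qed

section \<open>Units and infinite families of fields\<close>

text \<open>This is the square of sqrt(n) + sqrt(n - 1). The conjugate is the square of the
  difference, the two have product 1, and adding 1 gives 2 sqrt(n) (sqrt(n) + sqrt(n - 1)), the
  source of the relation with 4 n.\<close>

definition pell_unit :: "int \<Rightarrow> real" where
  "pell_unit n = 2 * of_int n - 1 + 2 * sqrt (of_int (n * (n - 1)))"

lemma pell_unit_props:
  assumes n: "n > 1" and L: "real_subfield L" and s: "sqrt (of_int (n * (n - 1))) \<in> L"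
  shows "is_unit_of L (pell_unit n)" "totally_positive L (pell_unit n)" "pell_unit n > 0"
    "(1 + pell_unit n)\<^sup>2 = 4 * of_int n * pell_unit n"
proof -
  define w where "w = sqrt (of_int (n * (n - 1)))"
  have w2: "w * w = of_int n * (of_int n - 1)" using n by (simp add: w_def)
  have w0: "w > 0" using n by (simp add: w_def)
  have wL: "w \<in> L" using s by (simp add: w_def)
  let ?u = "2 * of_int n - 1 + 2 * w" and ?v = "2 * of_int n - 1 - 2 * w"
  have u: "pell_unit n = ?u" by (simp add: pell_unit_def w_def)
  have uv: "?u * ?v = 1" using w2 by (simp add: algebra_simps)
  have n1: "(of_int n :: real) > 1" using n by simp
  have u0: "?u > 0" using w0 n1 by simp
  have v0: "?v > 0" using uv u0 by (metis zero_less_mult_pos zero_less_one)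
  have inL: "?u \<in> L" by (intro subfield_intros L wL)
  show "pell_unit n > 0" using u u0 by simp
  show "(1 + pell_unit n)\<^sup>2 = 4 * of_int n * pell_unit n"
    unfolding u power2_eq_square using w2 by (simp add: algebra_simps)
  have alg: "algebraic_int x" if "x * x - (4 * of_int n - 2) * x + 1 = 0" for x :: real
  proof -
    define q :: "int poly" where "q = [:1, - (4 * n - 2), 1:]"
    have "poly (map_poly of_int q) x = 0"
      using that by (simp add: q_def map_poly_pCons algebra_simps)
    moreover have "lead_coeff q = 1" by (simp add: q_def)
    ultimately show ?thesis by (auto simp: algebraic_int_altdef_ipoly)
  qed
  have "algebraic_int ?u" "algebraic_int ?v"
    by (rule alg; use w2 in \<open>simp add: algebra_simps\<close>)+
  moreover have "inverse ?u = ?v" using uv by (simp add: inverse_unique)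
  ultimately show "is_unit_of L (pell_unit n)"
    using inL u0 unfolding is_unit_of_def u by simp
  show "totally_positive L (pell_unit n)"
    unfolding totally_positive_def u
  proof (intro conjI ballI inL)
    fix \<sigma> assume "\<sigma> \<in> real_embeddings L"
    then have h: "field_hom L \<sigma>" by (simp add: real_embeddings_def field_hom_def)
    have "\<sigma> w = w \<or> \<sigma> w = - w"
      unfolding w_def by (rule field_hom_sqrt_cases[OF h L]) (use n s in auto)
    moreover have "2 * of_int n - 1 = (of_int (2 * n - 1) :: real)" by simp
    then have "\<sigma> ?u = 2 * of_int n - 1 + of_int 2 * \<sigma> w"
      using field_hom_add[OF h, of "of_int (2 * n - 1)" "of_int 2 * w"] field_hom_mult[OF h, of "of_int 2" w]
        field_hom_of_int[OF h L, of 2] field_hom_of_int[OF h L, of "2 * n - 1"]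
        subfield_of_int[OF L, of 2] subfield_of_int[OF L, of "2 * n - 1"] wL subfield_mult[OF L, of "of_int 2" w]
      by (simp only:) simp
    ultimately show "\<sigma> ?u > 0" using u0 v0 by auto
  qed
qed

lemma even_multiplicity_square:
  assumes "prime p" "(w :: int) \<noteq> 0"
  shows "even (multiplicity p (w\<^sup>2))"
  using prime_elem_multiplicity_power_distrib[OF prime_imp_prime_elem[OF assms(1)] assms(2), of 2] by simp

lemma multiplicity_mult_int:
  assumes "prime (p::int)" "x \<noteq> 0" "y \<noteq> 0"
  shows "multiplicity p (x * y) = multiplicity p x + multiplicity p y"
  by (rule prime_elem_multiplicity_mult_distrib[OF prime_imp_prime_elem]) (rule assms)+

text \<open>The \<open>q\<close>-th field is generated by the roots of \<open>d\<close> over the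
  \<open>q\<close>-th window of length \<open>r * t\<close> and carries the units of the
  \<open>q\<close>-th window of length \<open>k * t\<close> of \<open>n\<close>. Hypothesis
  \<open>unit\<close> keeps each unit within its own group of \<open>r\<close> generators, and a
  window consists of \<open>t\<close> whole groups.\<close>

theorem infinite_multiquadratic_fields:
  fixes d n :: "nat \<Rightarrow> int" and r k t :: nat
  assumes d: "\<And>i. d i > 0" and n: "\<And>j. n j > 1"
    and indep: "\<And>B C. finite B \<Longrightarrow> finite C \<Longrightarrow> B \<union> C \<noteq> {} \<Longrightarrow> \<nexists>w. prod d B * prod n C = w\<^sup>2"
    and unit: "\<And>j. \<exists>S\<subseteq>{r * (j div k)..<r * (j div k) + r}. \<exists>w. n j * (n j - 1) * prod d S = w\<^sup>2"
    and pos: "r > 0" "k > 0" "t > 0"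
  shows "infinite {L. real_multiquadratic L \<and> gal L \<cong> elem2_group (r * t) \<and>
            (\<exists>u. (\<forall>i<k * t. is_unit_of L (u i) \<and> totally_positive L (u i)) \<and>
                 indep_mod_squares L u (k * t))}" (is "infinite ?X")
proof -
  define I where "I q = {q * (r * t)..<q * (r * t) + r * t}" for q
  define L where "L q = sqrt_field d (I q)" for q
  have sf: "real_subfield (L q)" for q by (simp add: L_def real_subfield_sqrt_field)
  have prodpos: "prod d B > 0" "prod n C > 0" for B C
    using d n by (simp_all add: prod_pos less_trans[OF zero_less_one])
  \<comment> \<open>All of \<open>indep\<close> enters through this fact. A single index in
    \<open>B\<close> gives the Galois group and the distinctness of the fields; \<open>C\<close>
    gives the independence of the units.\<close>
  have notin: "sqrt (of_int (prod d B * prod n C)) \<notin> sqrt_field d J"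
    if BCJ: "finite B" "finite C" "finite J" "B \<union> C \<noteq> {}" "B \<inter> J = {}" for B C J
  proof
    assume "sqrt (of_int (prod d B * prod n C)) \<in> sqrt_field d J"
    then obtain B' where B': "B' \<subseteq> J" "sqrt (of_int (prod d B * prod n C * prod d B')) \<in> \<rat>"
      using sqrt_in_sqrt_field_imp[of J d "prod d B * prod n C"] BCJ(3) d prodpos
      by (metis mult_pos_pos)
    have "finite B'" using B'(1) BCJ(3) finite_subset by blast
    obtain w where "prod d B * prod n C * prod d B' = w\<^sup>2"
      using int_square_if_sqrt_Rats[OF B'(2)] prodpos[THEN less_imp_le] by auto
    moreover have "prod d B * prod n C * prod d B' = prod d (B \<union> B') * prod n C"
      using BCJ B' \<open>finite B'\<close> by (subst prod.union_disjoint) auto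
    ultimately show False
      using indep[of "B \<union> B'" C] BCJ \<open>finite B'\<close> by auto
  qed
  have "L q \<in> ?X" for q
  proof -
    have "real_multiquadratic (L q)"
      unfolding real_multiquadratic_def
    proof (intro exI conjI)
      show "finite ((\<lambda>i. of_int (d i) :: rat) ` I q)" by (simp add: I_def)
      show "\<forall>x\<in>(\<lambda>i. of_int (d i) :: rat) ` I q. x > 0" using d by simp
      show "L q = gen_subfield ((\<lambda>d. sqrt (of_rat d)) ` (\<lambda>i. of_int (d i)) ` I q)"
        by (simp add: L_def sqrt_field_def image_image)
    qed
    moreover have "gal (L q) \<cong> elem2_group (r * t)"
    proof -
      define d' where "d' i = d (q * (r * t) + i)" for i
      have "sqrt_field d' {..<m} = sqrt_field d {q * (r * t)..<q * (r * t) + m}" for m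
      proof -
        have "{q * (r * t)..<q * (r * t) + m} = (+) (q * (r * t)) ` {..<m}"
          by (simp add: lessThan_atLeast0 add.commute)
        then show ?thesis by (simp add: sqrt_field_def image_image d'_def)
      qed
      note eq = this
      have "sqrt (of_int (d' i)) \<notin> sqrt_field d' {..<i}" for i
        using notin[of "{q * (r * t) + i}" "{}"] unfolding eq by (simp add: d'_def)
      then have "gal (sqrt_field d' {..<r * t}) \<cong> elem2_group (r * t)"
        by (intro gal_sqrt_field) (auto simp: d'_def d)
      then show ?thesis by (simp add: eq L_def I_def)
    qed
    moreover have "\<exists>u. (\<forall>i<k * t. is_unit_of (L q) (u i) \<and> totally_positive (L q) (u i)) \<and>
                 indep_mod_squares (L q) u (k * t)"
    proof (intro exI conjI allI impI)
      define m where "m j = n (q * (k * t) + j)" for j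
      have sq: "sqrt (of_int (m j * (m j - 1))) \<in> L q" if "j < k * t" for j
      proof -
        have "q * (k * t) + j = j + k * (q * t)" by (simp add: algebra_simps)
        moreover have "(j + k * (q * t)) div k = q * t + j div k"
          using pos by (intro div_mult_self2) simp
        ultimately have "(q * (k * t) + j) div k = q * t + j div k" by (simp only:)
        then obtain S w where S: "S \<subseteq> {r * (q * t + j div k)..<r * (q * t + j div k) + r}"
          "m j * (m j - 1) * prod d S = w\<^sup>2" using unit[of "q * (k * t) + j"] by (auto simp: m_def)
        have "j div k < t" using that pos by (simp add: less_mult_imp_div_less mult.commute)
        then have "r * Suc (j div k) \<le> r * t" by (intro mult_le_mono2) simp
        moreover have "r * (q * t + j div k) = q * (r * t) + r * (j div k)"
          by (simp add: algebra_simps)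
        ultimately have SI: "S \<subseteq> I q" using S(1) by (auto simp: I_def)
        have fS: "finite S" using S(1) finite_subset by blast
        have "sqrt (of_int (prod d S)) = (\<Prod>i\<in>S. sqrt (of_int (d i)))"
          using fS by (induction S rule: finite_induct) (auto simp: real_sqrt_mult)
        also have "\<dots> \<in> L q" unfolding L_def
          by (intro subfield_prod real_subfield_sqrt_field sqrt_in_sqrt_field) (use SI in auto)
        finally have inL: "sqrt (of_int (prod d S)) \<in> L q" .
        have "sqrt (of_int (m j * (m j - 1))) * sqrt (of_int (prod d S)) = sqrt (of_int (w\<^sup>2))"
          by (simp only: S(2)[symmetric] of_int_mult real_sqrt_mult)
        also have "\<dots> = of_int \<bar>w\<bar>" by simp
        finally have "sqrt (of_int (m j * (m j - 1))) * sqrt (of_int (prod d S)) = of_int \<bar>w\<bar>" .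
        moreover have "sqrt (of_int (prod d S)) \<noteq> 0"
          using prodpos(1)[of S] by (simp del: of_int_prod)
        ultimately have "sqrt (of_int (m j * (m j - 1))) = of_int \<bar>w\<bar> / sqrt (of_int (prod d S))"
          by (simp only: nonzero_eq_divide_eq not_False_eq_True)
        then show ?thesis using subfield_divide[OF sf subfield_of_int[OF sf] inL] by (simp only:)
      qed
      note P = pell_unit_props[OF n sf sq[unfolded m_def], folded m_def]
      show "is_unit_of (L q) (pell_unit (m i))" "totally_positive (L q) (pell_unit (m i))"
        if "i < k * t" for i using P[OF that] by auto
      show "indep_mod_squares (L q) (\<lambda>i. pell_unit (m i)) (k * t)"
        unfolding indep_mod_squares_def
      proof (intro allI impI notI)
        fix S assume S: "S \<subseteq> {..<k * t} \<and> S \<noteq> {}" and "\<exists>y\<in>L q. (\<Prod>i\<in>S. pell_unit (m i)) = y\<^sup>2"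
        then obtain y where y: "y \<in> L q" "(\<Prod>i\<in>S. pell_unit (m i)) = y\<^sup>2" by blast
        have fS: "finite S" using S finite_subset by blast
        have u0: "pell_unit (m i) > 0" if "i \<in> S" for i using P(3) S that by auto
        have "y \<noteq> 0" using y(2) prod_pos[of S "\<lambda>i. pell_unit (m i)"] u0 by auto
        \<comment> \<open>Multiplying the relations (1 + \<epsilon>)^2 = 4 n \<epsilon> over
          \<open>S\<close> and dividing by the assumed square \<open>y\<^sup>2\<close> exhibits the
          product of the \<open>m i\<close> as a square in the field.\<close>
        define x where "x = (\<Prod>i\<in>S. 1 + pell_unit (m i)) / (2 ^ card S * y)"
        have xL: "x \<in> L q" unfolding x_def
          using P(1) S by (intro subfield_intros sf y(1)) (auto simp: is_unit_of_def)
        have "(\<Prod>i\<in>S. 1 + pell_unit (m i))\<^sup>2 = (\<Prod>i\<in>S. 4 * of_int (m i) * pell_unit (m i))"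
          unfolding prod_power_distrib using P(4) S by (intro prod.cong) auto
        also have "\<dots> = 4 ^ card S * of_int (\<Prod>i\<in>S. m i) * y\<^sup>2"
          using y(2) by (simp add: prod.distrib)
        also have "(4::real) ^ card S = (2 ^ card S)\<^sup>2"
          by (simp flip: power_mult_distrib add: power2_eq_square)
        finally have "x\<^sup>2 = of_int (\<Prod>i\<in>S. m i)"
          using \<open>y \<noteq> 0\<close> by (simp add: x_def power_divide power_mult_distrib)
        then have "sqrt (of_int (\<Prod>i\<in>S. m i)) = \<bar>x\<bar>" by (metis real_sqrt_abs)
        moreover have "\<bar>x\<bar> \<in> L q" using xL subfield_minus[OF sf xL] by (simp add: abs_if)
        moreover have "(\<Prod>i\<in>S. m i) = prod n ((+) (q * (k * t)) ` S)"
          by (subst prod.reindex) (auto simp: m_def)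
        ultimately show False
          using notin[of "{}" "(+) (q * (k * t)) ` S" "I q"] fS S by (simp add: L_def I_def)
      qed
    qed
    ultimately show ?thesis by blast
  qed
  moreover have "inj L"
  proof
    fix q q' assume eq: "L q = L q'"
    show "q = q'"
    proof (rule ccontr)
      assume "q \<noteq> q'"
      have "q * (r * t) \<notin> I q'"
      proof
        assume "q * (r * t) \<in> I q'"
        then have "q' * (r * t) \<le> q * (r * t)" "q * (r * t) < Suc q' * (r * t)" by (auto simp: I_def)
        then show False using pos \<open>q \<noteq> q'\<close> by (simp only: mult_le_cancel2 mult_less_cancel2) auto
      qed
      then have "sqrt (of_int (d (q * (r * t)))) \<notin> L q'"
        using notin[of "{q * (r * t)}" "{}" "I q'"] by (simp add: L_def I_def)
      moreover have "sqrt (of_int (d (q * (r * t)))) \<in> L q"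
        unfolding L_def by (rule sqrt_in_sqrt_field) (use pos in \<open>simp add: I_def\<close>)
      ultimately show False using eq by simp
    qed
  qed
  ultimately show ?thesis
    by (meson finite_subset image_subsetI range_inj_infinite)
qed

text \<open>Blocks are chosen recursively, the next bound being at least every entry chosen before.
  In a product over \<open>A\<close>, the last block that occurs brings a prime beyond its bound to
  an odd power, and the positive entries of earlier blocks are too small to be divisible by
  it.\<close>

lemma independent_blocks:
  fixes P :: "(nat \<Rightarrow> int) \<Rightarrow> bool"
  assumes "\<And>N::int. \<exists>g. P g \<and> (\<forall>i<m. g i > 0) \<and>
    (\<forall>A\<subseteq>{..<m}. A \<noteq> {} \<longrightarrow> (\<exists>p. prime p \<and> p > N \<and> odd (multiplicity p (prod g A))))"
  shows "\<exists>g :: nat \<Rightarrow> nat \<Rightarrow> int. (\<forall>b. P (g b) \<and> (\<forall>i<m. g b i > 0)) \<and>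
    (\<forall>A. finite A \<longrightarrow> A \<noteq> {} \<longrightarrow> A \<subseteq> UNIV \<times> {..<m} \<longrightarrow> (\<nexists>w. (\<Prod>(b, i)\<in>A. g b i) = w\<^sup>2))"
proof -
  define Q where "Q N g \<longleftrightarrow> P g \<and> (\<forall>i<m. g i > 0) \<and>
    (\<forall>A\<subseteq>{..<m}. A \<noteq> {} \<longrightarrow> (\<exists>p. prime p \<and> p > N \<and> odd (multiplicity p (prod g A))))"
    for N :: int and g
  have "\<exists>f :: nat \<Rightarrow> int \<times> (nat \<Rightarrow> int). \<forall>b. Q (fst (f b)) (snd (f b)) \<and>
    (fst (f b) \<le> fst (f (Suc b)) \<and> (\<forall>i<m. snd (f b) i \<le> fst (f (Suc b))))"
  proof (rule dependent_nat_choice)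
    show "\<exists>x. Q (fst x) (snd x)" using assms[of 0] by (auto simp: Q_def)
  next
    fix x :: "int \<times> (nat \<Rightarrow> int)" and b :: nat
    define N where "N = Max (insert (fst x) (snd x ` {..<m}))"
    obtain g where "Q N g" using assms[of N] by (auto simp: Q_def)
    moreover have "fst x \<le> N" "\<forall>i<m. snd x i \<le> N" by (auto simp: N_def)
    ultimately show "\<exists>y. Q (fst y) (snd y) \<and> fst x \<le> fst y \<and> (\<forall>i<m. snd x i \<le> fst y)"
      by (intro exI[of _ "(N, g)"]) auto
  qed
  then obtain f :: "nat \<Rightarrow> int \<times> (nat \<Rightarrow> int)" where f: "\<And>b. Q (fst (f b)) (snd (f b))"
    "\<And>b. fst (f b) \<le> fst (f (Suc b))" "\<And>b i. i < m \<Longrightarrow> snd (f b) i \<le> fst (f (Suc b))"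
    by blast
  define N where "N b = fst (f b)" for b
  define g where "g b = snd (f b)" for b
  have mono: "N b \<le> N b'" if "b \<le> b'" for b b'
    using lift_Suc_mono_le[of N b b'] f(2) that by (simp add: N_def)
  have g: "P (g b)" "i < m \<Longrightarrow> g b i > 0" for b i using f(1)[of b] by (auto simp: Q_def g_def)
  have "\<nexists>w. (\<Prod>(b, i)\<in>A. g b i) = w\<^sup>2" if A: "finite A" "A \<noteq> {}" "A \<subseteq> UNIV \<times> {..<m}" for A
  proof
    assume "\<exists>w. (\<Prod>(b, i)\<in>A. g b i) = w\<^sup>2"
    then obtain w where w: "(\<Prod>(b, i)\<in>A. g b i) = w\<^sup>2" by blast
    define c where "c = Max (fst ` A)"
    have cA: "c \<in> fst ` A" using A unfolding c_def by (intro Max_in) auto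
    define A1 where "A1 = {i. (c, i) \<in> A}"
    have A1: "A1 \<subseteq> {..<m}" "A1 \<noteq> {}" using A cA by (auto simp: A1_def)
    obtain p where p: "prime p" "p > N c" "odd (multiplicity p (prod (g c) A1))"
      using f(1)[of c] A1 unfolding Q_def N_def g_def by blast
    define A2 where "A2 = A - Pair c ` A1"
    have "A = Pair c ` A1 \<union> A2" by (auto simp: A1_def A2_def)
    moreover have fin: "finite A1" "finite A2"
      using A A1(1) finite_subset by (auto simp: A2_def)
    ultimately have "(\<Prod>(b, i)\<in>A. g b i) = (\<Prod>(b, i)\<in>Pair c ` A1. g b i) * (\<Prod>(b, i)\<in>A2. g b i)"
      by (metis (no_types, lifting) A2_def Diff_disjoint finite_imageI prod.union_disjoint)
    also have "(\<Prod>(b, i)\<in>Pair c ` A1. g b i) = prod (g c) A1"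
      by (subst prod.reindex) (auto simp: inj_on_def)
    finally have eq: "w\<^sup>2 = prod (g c) A1 * (\<Prod>(b, i)\<in>A2. g b i)" using w by simp
    have nd: "\<not> p dvd (\<Prod>(b, i)\<in>A2. g b i)"
    proof
      assume "p dvd (\<Prod>(b, i)\<in>A2. g b i)"
      then obtain b i where bi: "(b, i) \<in> A2" "p dvd g b i"
        using p(1) fin(2) by (auto simp: prime_dvd_prod_iff)
      then have "(b, i) \<in> A" "b \<noteq> c" by (auto simp: A2_def A1_def)
      moreover from this have "b \<le> c" unfolding c_def using A(1) \<open>(b, i) \<in> A\<close> by (force intro: Max_ge)
      ultimately have "Suc b \<le> c" "i < m" using A by auto
      then have "g b i \<le> N c" using f(3)[of i b] mono[of "Suc b" c] by (simp add: g_def N_def)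
      moreover have "p \<le> g b i" using bi(2) g(2)[OF \<open>i < m\<close>, of b] by (rule zdvd_imp_le)
      ultimately show False using p(2) by simp
    qed
    have A1pos: "prod (g c) A1 > 0" using A1(1) g(2) by (intro prod_pos) auto
    have "(\<Prod>(b, i)\<in>A2. g b i) \<noteq> 0" using nd by auto
    then have "w \<noteq> 0" "multiplicity p (w\<^sup>2) = multiplicity p (prod (g c) A1)"
      using A1pos nd p(1) eq by (auto simp: multiplicity_mult_int not_dvd_imp_multiplicity_0)
    then show False using even_multiplicity_square[OF p(1), of w] p(3) by simp
  qed
  then show ?thesis using g by (intro exI[of _ g]) blast
qed

section \<open>Pell's equation\<close>

lemma square_cancel:
  fixes u v w :: int
  assumes "u * v\<^sup>2 = w\<^sup>2" "v \<noteq> 0"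
  shows "\<exists>t. u = t\<^sup>2"
proof -
  have "v\<^sup>2 dvd w\<^sup>2" using assms(1) by (metis dvd_triv_right)
  then obtain t where "w = v * t" by (auto simp: elim: dvdE)
  with assms have "u = t\<^sup>2" by (simp add: power_mult_distrib)
  then show ?thesis ..
qed

text \<open>Dirichlet approximation gives infinitely many pairs of bounded norm
  \<open>h\<^sup>2 - D * k\<^sup>2\<close>. By the pigeonhole principle two of them share the norm c
  and both coordinates modulo c; their quotient is integral of norm 1.\<close>

lemma pell_solution:
  fixes D :: int
  assumes "D > 0" and nsq: "\<nexists>w. D = w\<^sup>2"
  shows "\<exists>x y. x\<^sup>2 - D * y\<^sup>2 = 1 \<and> x > 0 \<and> y > 0"
proof -
  define \<alpha> where "\<alpha> = sqrt (of_int D)"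
  have \<alpha>2: "\<alpha>\<^sup>2 = of_int D" using assms(1) by (simp add: \<alpha>_def)
  have \<alpha>1: "\<alpha> \<ge> 1" using assms(1) by (simp add: \<alpha>_def)
  have norm0: "h\<^sup>2 - D * k\<^sup>2 \<noteq> 0" if "k > 0" for h k :: int
  proof
    assume "h\<^sup>2 - D * k\<^sup>2 = 0"
    then have "D * k\<^sup>2 = h\<^sup>2" by simp
    then show False using square_cancel[of D k h] nsq that by auto
  qed
  have fac: "of_int (h\<^sup>2 - D * k\<^sup>2) = (of_int h - of_int k * \<alpha>) * (of_int h + of_int k * \<alpha>)" for h k :: int
    by (simp add: algebra_simps power2_eq_square flip: \<alpha>2)
  \<comment> \<open>The norm is (h - k \<alpha>) (h + k \<alpha>). With k at most N and the first
    factor below 1 / N in absolute value, the second is at most 2 N \<alpha> + 1, whence the bound 2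
    \<alpha> + 1.\<close>
  define C where "C = \<lceil>2 * \<alpha> + 1\<rceil>"
  define S where "S = {(h, k). k > 0 \<and> h \<ge> 0 \<and> \<bar>h\<^sup>2 - D * k\<^sup>2\<bar> \<le> C}"
  have approx: "\<exists>(h, k) \<in> S. \<bar>of_int k * \<alpha> - of_int h\<bar> < 1 / real N" if "N > 0" for N
  proof -
    obtain h k where hk: "0 < k" "k \<le> int N" "\<bar>of_int k * \<alpha> - of_int h\<bar> < 1 / real N"
      using Dirichlet_approx[OF \<open>N > 0\<close>, of \<alpha>] by blast
    have N1: "1 / real N \<le> 1" using that by simp
    have k1: "(of_int k :: real) \<ge> 1" using hk(1) by simp
    have "of_int k * \<alpha> \<ge> 1 * 1" by (rule mult_mono) (use k1 \<alpha>1 in auto)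
    then have h0: "of_int h > (0::real)" using hk(3) N1 by linarith
    have "real_of_int k \<le> of_int (int N)" using hk(2) by (simp only: of_int_le_iff)
    then have kN: "of_int k * \<alpha> \<le> real N * \<alpha>" using \<alpha>1 by (intro mult_right_mono) auto
    have "\<bar>of_int (h\<^sup>2 - D * k\<^sup>2)\<bar> = \<bar>of_int k * \<alpha> - of_int h\<bar> * (of_int h + of_int k * \<alpha>)"
      unfolding fac abs_mult using h0 k1 \<alpha>1 by (simp add: abs_minus_commute)
    also have "\<dots> \<le> 1 / real N * (2 * (real N * \<alpha>) + 1)"
    proof (rule mult_mono)
      show "of_int h + of_int k * \<alpha> \<le> 2 * (real N * \<alpha>) + 1"
        using hk(3) N1 kN by linarith
    qed (use hk(3) h0 k1 \<alpha>1 in auto)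
    also have "\<dots> = 2 * \<alpha> + 1 / real N" using that by (simp add: field_simps)
    also have "\<dots> \<le> 2 * \<alpha> + 1" using N1 by simp
    finally have "\<bar>h\<^sup>2 - D * k\<^sup>2\<bar> \<le> C" unfolding C_def by linarith
    then show ?thesis using hk h0 by (intro bexI[of _ "(h, k)"]) (auto simp: S_def)
  qed
  have "infinite S"
  proof
    assume fin: "finite S"
    define e where "e = Min ((\<lambda>(h, k). \<bar>of_int k * \<alpha> - of_int h\<bar>) ` S)"
    have ne: "S \<noteq> {}" using approx[of 1] by auto
    have "e \<in> (\<lambda>(h, k). \<bar>of_int k * \<alpha> - of_int h\<bar>) ` S"
      unfolding e_def using fin ne by (intro Min_in) auto
    then obtain h k where hk: "(h, k) \<in> S" "e = \<bar>of_int k * \<alpha> - of_int h\<bar>" by auto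
    have "e \<noteq> 0"
    proof
      assume "e = 0"
      then have "of_int (h\<^sup>2 - D * k\<^sup>2) = (0 :: real)" unfolding fac using hk(2) by simp
      then show False using norm0[of k h] hk(1) by (simp only: of_int_eq_0_iff) (simp add: S_def)
    qed
    then have "e > 0" using hk(2) by simp
    then obtain m where m: "inverse (real (Suc m)) < e"
      using reals_Archimedean by blast
    define N where "N = Suc m"
    have N: "N > 0" "1 / real N < e" using m by (simp_all add: N_def inverse_eq_divide)
    obtain h' k' where "(h', k') \<in> S" "\<bar>of_int k' * \<alpha> - of_int h'\<bar> < 1 / real N"
      using approx[OF N(1)] by (auto simp only: split_paired_Bex_Sigma case_prod_conv Bex_def split_paired_Ex)
    moreover from this have "e \<le> \<bar>of_int k' * \<alpha> - of_int h'\<bar>"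
      unfolding e_def using fin by (intro Min_le) (auto intro!: image_eqI)
    ultimately show False using N(2) by simp
  qed
  moreover have "finite ((\<lambda>(h, k). h\<^sup>2 - D * k\<^sup>2) ` S)"
    by (rule finite_subset[of _ "{-C..C}"]) (auto simp: S_def)
  ultimately obtain p where "infinite {q \<in> S. (case q of (h, k) \<Rightarrow> h\<^sup>2 - D * k\<^sup>2) = (case p of (h, k) \<Rightarrow> h\<^sup>2 - D * k\<^sup>2)}" "p \<in> S"
    using pigeonhole_infinite by blast
  then obtain c where c: "infinite {(h, k) \<in> S. h\<^sup>2 - D * k\<^sup>2 = c}" "c \<noteq> 0"
    using norm0 by (cases p) (auto simp: S_def case_prod_unfold)
  define T where "T = {(h, k) \<in> S. h\<^sup>2 - D * k\<^sup>2 = c}"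
  have "finite ((\<lambda>(h, k). (h mod \<bar>c\<bar>, k mod \<bar>c\<bar>)) ` T)"
    by (rule finite_subset[of _ "{0..<\<bar>c\<bar>} \<times> {0..<\<bar>c\<bar>}"]) (use c(2) in auto)
  then obtain p where p: "infinite {q \<in> T. (case q of (h, k) \<Rightarrow> (h mod \<bar>c\<bar>, k mod \<bar>c\<bar>)) =
      (case p of (h, k) \<Rightarrow> (h mod \<bar>c\<bar>, k mod \<bar>c\<bar>))}" (is "infinite ?U") "p \<in> T"
    using pigeonhole_infinite[OF c(1)[folded T_def]] by blast
  have "infinite (?U - {p})" using p by simp
  then have "?U - {p} \<noteq> {}" by (metis finite.emptyI)
  then obtain h1 k1 h2 k2 where q: "(h1, k1) \<in> T" "(h2, k2) \<in> T" "(h1, k1) \<noteq> (h2, k2)"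
    "h1 mod \<bar>c\<bar> = h2 mod \<bar>c\<bar>" "k1 mod \<bar>c\<bar> = k2 mod \<bar>c\<bar>"
    using p(2) by (cases p) auto
  have n1: "h1\<^sup>2 - D * k1\<^sup>2 = c" "k1 > 0" "h1 \<ge> 0" and n2: "h2\<^sup>2 - D * k2\<^sup>2 = c" "k2 > 0" "h2 \<ge> 0"
    using q by (auto simp: T_def S_def)
  have "c dvd h2 - h1" "c dvd k2 - k1"
    using q(4,5) by (metis abs_dvd_iff mod_eq_dvd_iff)+
  then obtain a b where "h2 - h1 = c * a" "k2 - k1 = c * b" by (auto elim!: dvdE)
  then have ab: "h2 = h1 + c * a" "k2 = k1 + c * b" by simp_all
  \<comment> \<open>Here x + y sqrt(D) is the quotient of h2 + k2 sqrt(D) by h1 + k1 sqrt(D); the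
    congruences modulo c make it integral.\<close>
  define x where "x = 1 + h1 * a - D * k1 * b"
  define y where "y = h1 * b - k1 * a"
  have cx: "c * x = h1 * h2 - D * k1 * k2" unfolding x_def ab by (simp add: algebra_simps power2_eq_square flip: n1(1))
  have cy: "c * y = h1 * k2 - h2 * k1" unfolding y_def ab by (simp add: algebra_simps)
  have "c\<^sup>2 * (x\<^sup>2 - D * y\<^sup>2) = (c * x)\<^sup>2 - D * (c * y)\<^sup>2" by (simp add: algebra_simps power2_eq_square)
  also have "\<dots> = (h1\<^sup>2 - D * k1\<^sup>2) * (h2\<^sup>2 - D * k2\<^sup>2)"
    unfolding cx cy by (simp add: algebra_simps power2_eq_square)
  also have "\<dots> = c\<^sup>2" using n1 n2 by (simp add: power2_eq_square)
  finally have xy: "x\<^sup>2 - D * y\<^sup>2 = 1" using c(2) by simp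
  have "y \<noteq> 0"
  proof
    assume "y = 0"
    then have eq: "h1 * k2 = h2 * k1" using cy by simp
    have "c * k2\<^sup>2 = (h1 * k2)\<^sup>2 - D * k1\<^sup>2 * k2\<^sup>2"
      by (simp add: algebra_simps power_mult_distrib flip: n1(1))
    also have "\<dots> = c * k1\<^sup>2" unfolding eq
      by (simp add: algebra_simps power_mult_distrib flip: n2(1))
    finally have "k1 = k2" using c(2) n1 n2 by (simp add: power2_eq_iff_nonneg)
    with eq n1 q(3) show False by simp
  qed
  moreover have "x \<noteq> 0"
  proof
    assume "x = 0"
    moreover have "D * y\<^sup>2 \<ge> 0" using assms(1) by simp
    ultimately show False using xy by simp
  qed
  ultimately show ?thesis using xy by (intro exI[of _ "\<bar>x\<bar>"] exI[of _ "\<bar>y\<bar>"]) simp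
qed

text \<open>The minimal \<open>a\<close> works: if \<open>a = b\<^sup>2\<close> with \<open>b\<close> odd then \<open>(b + 1) / 2\<close> is a smaller solution, and if
\<open>b\<close> is even then \<open>(b\<^sup>2 - 1) u\<close> is a square congruent to 3 modulo 4.\<close>

lemma nonsquare_pell_element:
  fixes D K u :: int
  assumes D: "D = K\<^sup>2 * u" "u mod 4 = 1" "K \<noteq> 0" "D > 0" and nsq: "\<nexists>w. D = w\<^sup>2"
  shows "\<exists>a>1. (\<exists>w. a * (a - 1) * D = w\<^sup>2) \<and> (\<nexists>b. a = b\<^sup>2)"
proof -
  define Q where "Q a \<longleftrightarrow> a > 1 \<and> (\<exists>w. a * (a - 1) * D = w\<^sup>2)" for a
  have "\<exists>a. Q a"
  proof -
    \<comment> \<open>Pell's equation is solved for 4 D so that x is odd: c = (x - 1) / 2 and c + 1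
      then have product \<open>D * y\<^sup>2\<close>, and c + 1 is a candidate for
      \<open>a\<close>.\<close>
    have "D * 2\<^sup>2 \<noteq> w\<^sup>2" for w
      using square_cancel[of D 2 w] nsq by (metis zero_neq_numeral)
    then have "\<nexists>w. 4 * D = w\<^sup>2" by (simp add: mult.commute)
    then obtain x y where xy: "x\<^sup>2 - 4 * D * y\<^sup>2 = 1" "x > 0" "y > 0"
      using pell_solution[of "4 * D"] D(4) by auto
    have "odd x"
    proof
      assume "even x"
      then have "even (x\<^sup>2 - 4 * D * y\<^sup>2)" by simp
      then show False using xy(1) by simp
    qed
    then obtain c where c: "x = 2 * c + 1" by (rule oddE)
    have "4 * ((c + 1) * c) = 4 * (D * y\<^sup>2)" using xy(1) unfolding c by (simp add: algebra_simps power2_eq_square)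
    then have eq: "(c + 1) * c = D * y\<^sup>2" by (metis mult_left_cancel zero_neq_numeral)
    have "c \<noteq> 0" using eq xy(3) D(4) by auto
    then have "c > 0" using xy(2) c by auto
    moreover have "(c + 1) * ((c + 1) - 1) * D = (D * y)\<^sup>2"
      using eq by (simp add: power2_eq_square)
    ultimately show ?thesis unfolding Q_def by (intro exI[of _ "c + 1"]) auto
  qed
  then obtain a where a: "Q a" and least: "\<And>b. Q b \<Longrightarrow> nat a \<le> nat b"
    using ex_has_least_nat[of Q _ nat] by blast
  have "a \<noteq> b\<^sup>2" for b
  proof
    assume ab: "a = b\<^sup>2"
    define b' where "b' = \<bar>b\<bar>"
    have ab: "a = b'\<^sup>2" using ab by (simp add: b'_def)
    have "b' > 1"
    proof (rule ccontr)
      assume "\<not> b' > 1"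
      then have "b' = 0 \<or> b' = 1" by (auto simp: b'_def)
      then show False using a ab by (auto simp: Q_def)
    qed
    obtain w where "a * (a - 1) * D = w\<^sup>2" using a by (auto simp: Q_def)
    then have "(b'\<^sup>2 - 1) * D * b'\<^sup>2 = w\<^sup>2" using ab by (simp add: mult_ac)
    then obtain v where v: "(b'\<^sup>2 - 1) * D = v\<^sup>2" using square_cancel \<open>b' > 1\<close> by (metis not_one_less_zero)
    show False
    proof (cases "even b'")
      case True
      have "((b'\<^sup>2 - 1) * u) * K\<^sup>2 = v\<^sup>2" using v D(1) by (simp add: mult_ac)
      then obtain t where t: "(b'\<^sup>2 - 1) * u = t\<^sup>2" using square_cancel D(3) by blast
      obtain c where c: "b' = 2 * c" using True by (rule evenE)
      have "t\<^sup>2 mod 4 = ((b'\<^sup>2 - 1) mod 4) * (u mod 4) mod 4" by (simp add: mod_mult_eq flip: t)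
      also have "(b'\<^sup>2 - 1) mod 4 = 3" unfolding c
        by (simp add: power_mult_distrib) presburger
      finally have "t\<^sup>2 mod 4 = 3" using D(2) by simp
      moreover have "t\<^sup>2 mod 4 = (t mod 4)\<^sup>2 mod 4" by (simp add: power_mod)
      moreover have "t mod 4 = 0 \<or> t mod 4 = 1 \<or> t mod 4 = 2 \<or> t mod 4 = 3" by presburger
      ultimately show False by auto
    next
      case False
      then obtain c where c: "b' = 2 * c + 1" by (rule oddE)
      have "((c + 1) * c * D) * 2\<^sup>2 = v\<^sup>2" using v unfolding c by (simp add: algebra_simps power2_eq_square)
      then obtain t where "(c + 1) * c * D = t\<^sup>2" using square_cancel[of "(c + 1) * c * D" 2 v] by auto
      then have "Q (c + 1)" using c \<open>b' > 1\<close> by (auto simp: Q_def)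
      then have "nat a \<le> nat (c + 1)" by (rule least)
      moreover have "b'\<^sup>2 > b'" using \<open>b' > 1\<close> by (simp add: power2_eq_square)
      ultimately show False using ab c \<open>b' > 1\<close> by simp
    qed
  qed
  then show ?thesis using a by (auto simp: Q_def)
qed

section \<open>Arbitrarily large primes congruent to 3 modulo 4\<close>

lemma prime_factor_3_mod_4:
  fixes n :: nat
  assumes "n mod 4 = 3"
  shows "\<exists>p. prime p \<and> p dvd n \<and> p mod 4 = 3"
  using assms
proof (induction n rule: less_induct)
  case (less n)
  have "n \<noteq> 1" using less.prems by auto
  then obtain p where p: "prime p" "p dvd n" using prime_factor_nat by blast
  then obtain m where m: "n = p * m" by (elim dvdE)
  have nm: "(p mod 4) * (m mod 4) mod 4 = 3" using less.prems by (simp add: m mod_mult_eq)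
  show ?case
  proof (cases "p mod 4 = 3")
    case False
    have "p mod 4 = 0 \<or> p mod 4 = 1 \<or> p mod 4 = 2 \<or> p mod 4 = 3" "m mod 4 = 0 \<or> m mod 4 = 1 \<or> m mod 4 = 2 \<or> m mod 4 = 3"
      by presburger+
    then have "m mod 4 = 3" using nm False by auto
    moreover from this have "m > 0" by (intro gr0I) auto
    then have "m < n" using prime_gt_1_nat[OF p(1)] by (simp add: m)
    ultimately show ?thesis using less.IH[of m] by (auto simp: m)
  qed (use p in blast)
qed

text \<open>Euclid's argument with four times a factorial minus 1: this is 3 modulo 4, so some prime
  factor is too, and no prime up to \<open>N\<close> divides it.\<close>

lemma ex_prime_3_mod_4: "\<exists>p :: int. prime p \<and> p mod 4 = 3 \<and> p > N"
proof -
  define n where "n = 4 * fact (nat N) - (1 :: nat)"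
  have f: "fact (nat N) \<ge> (1 :: nat)" by (rule fact_ge_1)
  have "(4 * m - 1) mod 4 = 3" if m: "m \<ge> 1" for m :: nat
  proof -
    obtain k where "m = Suc k" using m by (cases m) auto
    then have "4 * m - 1 = 3 + k * 4" by simp
    then show ?thesis by (simp only: mod_mult_self1) simp
  qed
  then have "n mod 4 = 3" unfolding n_def using f by blast
  then obtain p where p: "prime p" "p dvd n" "p mod 4 = 3" using prime_factor_3_mod_4 by blast
  have "p > nat N"
  proof (rule ccontr)
    assume "\<not> p > nat N"
    then have "p dvd fact (nat N)" using p(1) by (simp add: prime_dvd_fact_iff)
    then have "p dvd 4 * fact (nat N)" by simp
    then have "p dvd 4 * fact (nat N) - n" using p(2) by (rule dvd_diff_nat)
    moreover have "4 * fact (nat N) - n = 1" using f by (simp add: n_def)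
    ultimately show False using p(1) by simp
  qed
  moreover have "int p mod 4 = 3" using p(3) by presburger
  ultimately show ?thesis using p by (intro exI[of _ "int p"]) auto
qed

section \<open>Quadratic characters and independence\<close>

lemma fermat_square_int:
  fixes p t :: int
  assumes p: "prime p" "odd p" and t: "\<not> p dvd t"
  shows "[(t\<^sup>2) ^ nat (p div 2) = 1] (mod p)"
proof -
  have p0: "p > 0" using p(1) by (rule prime_gt_0_int)
  have "\<not> nat p dvd nat \<bar>t\<bar>" using t p0
    by (metis abs_ge_zero dvd_abs_iff int_dvd_int_iff less_imp_le nat_0_le)
  moreover have "prime (nat p)" using p(1) by (simp add: prime_nat_iff_prime)
  ultimately have "[nat \<bar>t\<bar> ^ (nat p - 1) = 1] (mod nat p)" by (intro fermat_theorem)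
  then have "[int (nat \<bar>t\<bar> ^ (nat p - 1)) = int 1] (mod int (nat p))" by (simp only: cong_int_iff)
  moreover have "nat p - 1 = 2 * nat (p div 2)" using p(2) p0 by (auto elim!: oddE)
  ultimately have "[(\<bar>t\<bar>\<^sup>2) ^ nat (p div 2) = 1] (mod p)" using p0 by (simp add: power_mult)
  then show ?thesis by simp
qed

lemma odd_half_3_mod_4: "p mod 4 = 3 \<Longrightarrow> p > 0 \<Longrightarrow> odd (nat (p div 2))" for p :: int
  by (auto simp: even_nat_iff) presburger

lemma sign_power:
  assumes "s \<in> {1, -1 :: int}" "odd n"
  shows "s ^ n = s"
  using assms by auto

text \<open>For p = 3 modulo 4 the exponent (p - 1) / 2 is odd, so a sign survives the power while
  squares become 1 by Fermat. The factor \<open>c\<^sup>2\<close> allows \<open>x\<close> to be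
  given as the fraction s (d / c)^2.\<close>

lemma quadratic_sign:
  fixes p x c d s :: int
  assumes p: "prime p" "p mod 4 = 3" and s: "s \<in> {1, -1}"
    and cd: "\<not> p dvd c" "\<not> p dvd d" "[c\<^sup>2 * x = s * d\<^sup>2] (mod p)"
  shows "[x ^ nat (p div 2) = s] (mod p)"
proof -
  let ?e = "nat (p div 2)"
  have odd: "odd p" using p(2) by presburger
  have e: "odd ?e" using odd_half_3_mod_4 p prime_gt_0_int by blast
  have "[(c\<^sup>2) ^ ?e * x ^ ?e = s ^ ?e * (d\<^sup>2) ^ ?e] (mod p)"
    using cong_pow[OF cd(3), of ?e] by (simp only: power_mult_distrib)
  moreover have "[(c\<^sup>2) ^ ?e * x ^ ?e = 1 * x ^ ?e] (mod p)"
    by (intro cong_mult cong_refl fermat_square_int p(1) odd cd)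
  moreover have "[s ^ ?e * (d\<^sup>2) ^ ?e = s ^ ?e * 1] (mod p)"
    by (intro cong_mult cong_refl fermat_square_int p(1) odd cd)
  ultimately have "[1 * x ^ ?e = s ^ ?e * 1] (mod p)"
    by (metis cong_trans cong_sym)
  then show ?thesis using sign_power[OF s e] by simp
qed

text \<open>Half of Euler's criterion, applied to a square prime to \<open>p\<close>: the symbols of
  its factors multiply to 1, and that of \<open>c\<close> is \<open>s\<close>. The equation holds in
  the integers because 1 and -1 differ modulo \<open>p\<close>.\<close>

lemma square_sign_product:
  fixes p c s t :: int and f :: "nat \<Rightarrow> int"
  assumes p: "prime p" "p mod 4 = 3" and s: "s \<in> {1, -1}" "[c = s] (mod p)"
    and B: "finite B" "\<And>i. i \<in> B \<Longrightarrow> [f i ^ nat (p div 2) = (if i \<in> V then -1 else 1)] (mod p)"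
    and sq: "c * prod f B = t\<^sup>2"
  shows "s * (-1) ^ card (B \<inter> V) = 1"
proof -
  let ?e = "nat (p div 2)"
  have odd: "odd p" using p(2) by presburger
  have e: "odd ?e" using odd_half_3_mod_4 p prime_gt_0_int by blast
  have p2: "p > 2" using p prime_ge_2_int[of p] by (cases "p = 2") auto
  have p1: "\<not> p dvd s" using s(1) p(1) by auto
  have "\<not> p dvd f i" if "i \<in> B" for i
  proof
    assume "p dvd f i"
    then have "p dvd f i ^ ?e" using dvd_power[of ?e "f i"] odd_pos[OF e] by (metis dvd_trans)
    then have "p dvd (if i \<in> V then -1 else 1)" using B(2)[OF that] by (simp add: cong_dvd_iff)
    then show False using p(1) by (auto split: if_splits)
  qed
  then have "\<not> p dvd prod f B" using p(1) B(1) by (simp add: prime_dvd_prod_iff)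
  moreover have "\<not> p dvd c" using p1 s(2) by (simp add: cong_dvd_iff)
  ultimately have "\<not> p dvd t\<^sup>2" using p(1) by (simp flip: sq add: prime_dvd_mult_iff)
  then have "\<not> p dvd t" by (auto simp: power2_eq_square)
  then have "[(c * prod f B) ^ ?e = 1] (mod p)"
    unfolding sq by (intro fermat_square_int p(1) odd)
  moreover have "(c * prod f B) ^ ?e = c ^ ?e * (\<Prod>i\<in>B. f i ^ ?e)"
    by (simp add: power_mult_distrib prod_power_distrib)
  moreover have "[c ^ ?e * (\<Prod>i\<in>B. f i ^ ?e) = s ^ ?e * (\<Prod>i\<in>B. if i \<in> V then -1 else 1)] (mod p)"
    by (intro cong_mult cong_pow cong_prod s(2) B(2))
  moreover have "(\<Prod>i\<in>B. if i \<in> V then -1 else (1 :: int)) = (-1) ^ card (B \<inter> V)"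
    using B(1) by (simp add: prod.If_cases)
  ultimately have *: "[s * (-1) ^ card (B \<inter> V) = 1] (mod p)"
    using sign_power[OF s(1) e] by (metis cong_sym cong_trans)
  have "s * (-1) ^ card (B \<inter> V) = 1 \<or> s * (-1) ^ card (B \<inter> V) = (-1 :: int)"
    using s(1) by (cases "even (card (B \<inter> V))") auto
  moreover have "\<not> [-1 = 1] (mod p)"
  proof
    assume "[-1 = 1] (mod p)"
    then have "p dvd -1 - 1" by (simp only: cong_iff_dvd_diff)
    then have "p dvd 2" by simp
    then show False using p2 zdvd_imp_le[of p 2] by simp
  qed
  ultimately show ?thesis using * by auto
qed

section \<open>Marker primes and the independence of the atoms\<close>

lemma odd_multiplicity_forces_dvd:
  fixes p :: int
  assumes p: "prime p" and sq: "u * v = w\<^sup>2" and nz: "u \<noteq> 0" "v \<noteq> 0" and odd: "odd (multiplicity p v)"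
  shows "p dvd u"
proof (rule ccontr)
  assume "\<not> p dvd u"
  then have "multiplicity p (w\<^sup>2) = multiplicity p v"
    using p nz by (simp flip: sq add: multiplicity_mult_int not_dvd_imp_multiplicity_0)
  moreover have "w \<noteq> 0" using sq nz by auto
  ultimately show False using even_multiplicity_square[OF p] odd by metis
qed

text \<open>A marker prime for entry \<open>k\<close>: its multiplicity in a product over a subset
  tells whether \<open>k\<close> takes part. The bound \<open>m\<close> matters, since a marker
  among the first six atoms may divide one of the other three.\<close>

definition isolates :: "int \<Rightarrow> (nat \<Rightarrow> int) \<Rightarrow> nat \<Rightarrow> nat \<Rightarrow> bool" where
  "isolates p f m k \<longleftrightarrow> prime p \<and> multiplicity p (f k) = 1 \<and> (\<forall>i<m. i \<noteq> k \<longrightarrow> \<not> p dvd f i)"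

lemma isolates_multiplicity_prod:
  assumes iso: "isolates p f m k" and pos: "\<And>i. i < m \<Longrightarrow> f i \<noteq> 0" and B: "B \<subseteq> {..<m}"
  shows "multiplicity p (prod f B) = (if k \<in> B then 1 else 0)"
proof -
  have p: "prime p" using iso by (simp add: isolates_def)
  have fin: "finite B" using B finite_subset by blast
  have nz: "0 \<notin> f ` B" using B pos by force
  have "multiplicity p (prod f B) = (\<Sum>i\<in>B. multiplicity p (f i))"
    by (rule prime_elem_multiplicity_prod_distrib[OF prime_imp_prime_elem[OF p] nz fin])
  also have "\<dots> = (\<Sum>i\<in>B. if i = k then 1 else 0)"
    using iso B by (intro sum.cong) (auto simp: isolates_def not_dvd_imp_multiplicity_0)
  finally show ?thesis using fin by simp
qed

text \<open>Among the entries other than \<open>k\<close>, those in \<open>V\<close> are nonresidues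
  of the marker prime and the rest are residues; the Legendre symbol appears as Euler's
  power.\<close>

definition local_signs :: "(nat \<Rightarrow> int) \<Rightarrow> nat \<Rightarrow> nat \<Rightarrow> nat set \<Rightarrow> bool" where
  "local_signs f m k V \<longleftrightarrow> (\<exists>p. p mod 4 = 3 \<and> isolates p f m k \<and>
     (\<forall>i<m. i \<noteq> k \<longrightarrow> [f i ^ nat (p div 2) = (if i \<in> V then -1 else 1)] (mod p)))"

text \<open>A prime dividing exactly one atom divides \<open>a\<close> or \<open>a - 1\<close>, so that the other one is \<open>1\<close> or \<open>-1\<close>
modulo the prime; as \<open>-1\<close> is a non-residue this gives a linear condition on \<open>J\<close>.\<close>

lemma local_signs_parity:
  assumes loc: "local_signs f m k V" and k: "k < m" and V: "V \<subseteq> {..<m} - {k}"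
    and pos: "\<And>i. i < m \<Longrightarrow> f i \<noteq> 0" and a: "a > 1"
    and J: "J \<subseteq> {..<m}"
    and sq: "a * prod f J = t\<^sup>2" "(a - 1) * prod f ({..<m} - J) = t'\<^sup>2"
  shows "if k \<in> J then odd (card (V - J)) else even (card (V \<inter> J))"
proof -
  obtain p where p: "p mod 4 = 3" "isolates p f m k"
    "\<And>i. i < m \<Longrightarrow> i \<noteq> k \<Longrightarrow> [f i ^ nat (p div 2) = (if i \<in> V then -1 else 1)] (mod p)"
    using loc by (auto simp: local_signs_def)
  have pp: "prime p" using p(2) by (simp add: isolates_def)
  have nz: "prod f B \<noteq> 0" if "B \<subseteq> {..<m}" for B
    using that pos finite_subset[OF that] by (force simp: prod_zero_iff)
  have fJ: "finite J" using J finite_subset by blast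
  show ?thesis
  proof (cases "k \<in> J")
    case True
    have "p dvd a"
      using odd_multiplicity_forces_dvd[OF pp sq(1) _ nz[OF J]] isolates_multiplicity_prod[OF p(2) pos J] a True
      by simp
    then have c: "[a - 1 = -1] (mod p)" by (simp add: cong_iff_dvd_diff)
    have "(-1) * (-1) ^ card (({..<m} - J) \<inter> V) = (1 :: int)"
    proof (rule square_sign_product[OF pp p(1) _ c _ _ sq(2)])
      fix i assume "i \<in> {..<m} - J"
      then have "i < m" "i \<noteq> k" using True by auto
      then show "[f i ^ nat (p div 2) = (if i \<in> V then -1 else 1)] (mod p)" by (rule p(3))
    qed auto
    moreover have "({..<m} - J) \<inter> V = V - J" using V by auto
    ultimately show ?thesis using True by (cases "even (card (V - J))") auto
  next
    case False
    have "p dvd a - 1"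
      using odd_multiplicity_forces_dvd[OF pp sq(2) _ nz] isolates_multiplicity_prod[OF p(2) pos, of "{..<m} - J"] a False k
      by auto
    then have c: "[a = 1] (mod p)" by (simp add: cong_iff_dvd_diff)
    have "1 * (-1) ^ card (J \<inter> V) = (1 :: int)"
    proof (rule square_sign_product[OF pp p(1) _ c fJ _ sq(1)])
      fix i assume "i \<in> J"
      then have "i < m" "i \<noteq> k" using False J by auto
      then show "[f i ^ nat (p div 2) = (if i \<in> V then -1 else 1)] (mod p)" by (rule p(3))
    qed auto
    then show ?thesis using False by (cases "even (card (V \<inter> J))") (auto simp: Int_commute)
  qed
qed

lemma product_square_reduce:
  fixes f :: "nat \<Rightarrow> int"
  assumes "finite I" "\<And>i. i \<in> I \<Longrightarrow> f i \<noteq> 0" "u * (\<Prod>i\<in>I. f i ^ c i) = w\<^sup>2"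
  shows "\<exists>t. u * prod f {i \<in> I. odd (c i)} = t\<^sup>2"
proof -
  have "(\<Prod>i\<in>I. f i ^ c i) = (\<Prod>i\<in>I. (if odd (c i) then f i else 1) * (f i ^ (c i div 2))\<^sup>2)"
  proof (rule prod.cong)
    fix i assume "i \<in> I"
    show "f i ^ c i = (if odd (c i) then f i else 1) * (f i ^ (c i div 2))\<^sup>2"
      by (cases "even (c i)") (auto elim!: evenE oddE simp: power_mult power_add mult.commute[of 2])
  qed simp
  also have "\<dots> = (\<Prod>i\<in>I. if odd (c i) then f i else 1) * (\<Prod>i\<in>I. f i ^ (c i div 2))\<^sup>2"
    by (simp only: prod.distrib prod_power_distrib)
  also have "(\<Prod>i\<in>I. if odd (c i) then f i else 1) = prod f {i \<in> I. odd (c i)}"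
    using assms(1) by (simp add: prod.inter_filter)
  finally have "(u * prod f {i \<in> I. odd (c i)}) * (\<Prod>i\<in>I. f i ^ (c i div 2))\<^sup>2 = w\<^sup>2"
    using assms(3) by (simp add: mult.assoc)
  moreover have "(\<Prod>i\<in>I. f i ^ (c i div 2)) \<noteq> 0" using assms by simp
  ultimately show ?thesis by (rule square_cancel)
qed

text \<open>As \<open>a\<close> and \<open>a - 1\<close> are coprime, a prime dividing
  \<open>a\<close> has even multiplicity in \<open>a * D\<close>. Hence only primes of odd
  multiplicity in \<open>D\<close> can show up in the class of \<open>a\<close>.\<close>

lemma even_multiplicity_pell:
  fixes a D w p :: int
  assumes "prime p" "a > 1" "D \<noteq> 0" "a * (a - 1) * D = w\<^sup>2" "even (multiplicity p D)"
  shows "even (multiplicity p a)"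
proof (cases "p dvd a")
  case True
  have "\<not> p dvd a - 1"
  proof
    assume "p dvd a - 1"
    with True have "p dvd a - (a - 1)" by (rule dvd_diff)
    then show False using prime_gt_1_int[OF assms(1)] by simp
  qed
  then have "multiplicity p (w\<^sup>2) = multiplicity p a + multiplicity p D"
    using assms by (simp flip: assms(4) add: multiplicity_mult_int not_dvd_imp_multiplicity_0)
  moreover have "w \<noteq> 0" using assms by auto
  ultimately show ?thesis using even_multiplicity_square[OF assms(1), of w] assms(5) by simp
qed (simp add: not_dvd_imp_multiplicity_0)

text \<open>\<open>J\<close> is the set of odd exponents. Markers of the atoms 6, 7, 8 have even
  multiplicity in \<open>a\<close> too, so these atoms drop out; for even \<open>b\<close> markers
  settle the rest. For odd \<open>b\<close> the multiplicity in \<open>a\<close> of a marker of the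
  first six atoms is unknown, and residue symbols take over.\<close>

lemma atoms_independent:
  fixes f :: "nat \<Rightarrow> int" and a :: int
  assumes pos: "\<And>i. i < 9 \<Longrightarrow> f i > 0" and a: "a > 1" "\<nexists>b. a = b\<^sup>2"
    and pell: "a * (a - 1) * prod f {..<6} = z\<^sup>2"
    and iso9: "\<And>k. k \<in> {6,7,8} \<Longrightarrow> \<exists>p. isolates p f 9 k"
    and iso6: "\<And>k. k \<in> {0,1,5} \<Longrightarrow> \<exists>p. isolates p f 6 k"
    and loc: "local_signs f 6 2 {0}" "local_signs f 6 2 {0,1}" "local_signs f 6 2 {}"
      "local_signs f 6 3 {0,2,5}" "local_signs f 6 3 {0,1,2,5}" "local_signs f 6 4 {2,5}"
    and sq: "a ^ b * (\<Prod>i<9. f i ^ c i) = w\<^sup>2"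
  shows "even b \<and> (\<forall>i<9. even (c i))"
proof -
  define J where "J = {i \<in> {..<9}. odd (c i)}"
  define u where "u = (if even b then 1 else a)"
  have u0: "u \<noteq> 0" using a by (simp add: u_def)
  have nz: "f i \<noteq> 0" if "i < 9" for i using pos[OF that] by simp
  have "a ^ b = u * (a ^ (b div 2))\<^sup>2"
    by (cases "even b") (auto elim!: evenE oddE simp: u_def power_mult mult.commute[of 2])
  then have "(u * (\<Prod>i<9. f i ^ c i)) * (a ^ (b div 2))\<^sup>2 = w\<^sup>2" using sq by (simp add: mult_ac)
  then obtain w' where "u * (\<Prod>i<9. f i ^ c i) = w'\<^sup>2" using square_cancel a(1) by (metis not_one_less_zero power_eq_0_iff)
  then obtain t where t: "u * prod f J = t\<^sup>2"
    using product_square_reduce[of "{..<9}" f u c w'] nz by (auto simp: J_def)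
  have J9: "J \<subseteq> {..<9}" by (auto simp: J_def)
  have Dnz: "prod f {..<6} \<noteq> 0" using nz by simp
  have fJnz: "prod f J \<noteq> 0" using nz J9 finite_subset[OF J9] by (auto simp: prod_zero_iff)
  have notin: "k \<notin> J" if iso: "isolates p f m k" and m: "m = 9 \<or> m = 6 \<and> J \<subseteq> {..<6}"
    and ev: "even (multiplicity p u)" for p m k
  proof
    assume k: "k \<in> J"
    have p: "prime p" using iso by (simp add: isolates_def)
    have "multiplicity p (prod f J) = 1"
      using isolates_multiplicity_prod[OF iso nz, of J] k m J9 by auto
    then have "odd (multiplicity p (t\<^sup>2))" using ev multiplicity_mult_int[OF p u0 fJnz] t by simp
    moreover have "t \<noteq> 0" using t u0 fJnz by auto
    ultimately show False using even_multiplicity_square[OF p] by blast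
  qed
  have ev9: "even (multiplicity p u)" if "isolates p f 9 k" "k \<in> {6,7,8}" for p k
  proof -
    have p: "prime p" using that by (simp add: isolates_def)
    have "multiplicity p (prod f {..<6}) = 0"
      using isolates_multiplicity_prod[OF that(1) nz, of "{..<6}"] that(2) by auto
    then have "even (multiplicity p a)" using even_multiplicity_pell[OF p a(1) Dnz pell] by simp
    then show ?thesis by (simp add: u_def)
  qed
  have "6 \<notin> J" "7 \<notin> J" "8 \<notin> J" using iso9 notin ev9 by (metis insertI1 insertI2)+
  then have J6: "J \<subseteq> {..<6}" using J9 by (auto simp: less_Suc_eq numeral_eq_Suc)
  show ?thesis
  proof (cases "even b")
    case True
    then have u1: "u = 1" by (simp add: u_def)
    have "\<exists>p. isolates p f 6 k" if "k < 6" for k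
    proof -
      have "k \<in> {0,1,5} \<or> k = 2 \<or> k = 3 \<or> k = 4" using that by auto
      then show ?thesis using iso6 loc(1,4,6) unfolding local_signs_def by blast
    qed
    then have "k \<notin> J" if "k < 6" for k using notin[of _ 6 k] J6 that u1 by auto
    then have "J = {}" using J6 by auto
    then show ?thesis using True by (auto simp: J_def)
  next
    case False
    then have t: "a * prod f J = t\<^sup>2" using t by (simp add: u_def)
    have "prod f {..<6} = prod f J * prod f ({..<6} - J)"
      using prod.subset_diff[OF J6, of f] by (simp add: mult.commute)
    then have "((a - 1) * prod f ({..<6} - J)) * t\<^sup>2 = z\<^sup>2" using pell by (simp flip: t add: mult_ac)
    moreover have "t \<noteq> 0" using t a fJnz by auto
    ultimately obtain t' where t': "(a - 1) * prod f ({..<6} - J) = t'\<^sup>2" using square_cancel by blast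
    have par: "if k \<in> J then odd (card (V - J)) else even (card (V \<inter> J))"
      if "local_signs f 6 k V" "k < 6" "V \<subseteq> {..<6} - {k}" for k V
      by (rule local_signs_parity[OF that _ a(1) J6 t t']) (use nz in auto)
    \<comment> \<open>Each condition is linear over the field of two elements: for odd |V| it says
      that |V \<inter> J| is even, for even |V| that k lies in J exactly when |V \<inter> J| is odd.
      The sets \<open>V\<close> are chosen to make the system triangular in the order 0, 2, 1, 5, 3,
      4.\<close>
    have 0: "0 \<notin> J" using par[OF loc(1)] by (auto split: if_splits)
    have 2: "2 \<notin> J" using par[OF loc(3)] by (auto split: if_splits)
    have 1: "1 \<notin> J" using par[OF loc(2)] 0 2 by (auto split: if_splits)
    have 5: "5 \<notin> J" using par[OF loc(4)] 0 2 by (auto simp: insert_Diff_if split: if_splits)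
    have 3: "3 \<notin> J" using par[OF loc(5)] 0 1 2 5 by (auto simp: insert_Diff_if split: if_splits)
    have 4: "4 \<notin> J" using par[OF loc(6)] 2 5 by (auto simp: insert_Diff_if split: if_splits)
    have "J = {}" using J6 0 1 2 3 4 5 by (auto simp: less_Suc_eq numeral_eq_Suc)
    then show ?thesis using t a(2) by auto
  qed
qed

section \<open>Congruence conditions\<close>

text \<open>With \<open>S = s + 1\<close>, \<open>x = s r + 1\<close>, \<open>y = S r + 1\<close> the atoms are
\<open>s, S, z, A = s r y z + 1, B = S r x z + 1, C = x y z + 1, r, x, y\<close>. The integers
\<open>l\<^sub>4 = s S r x y z\<close>, \<open>l\<^sub>3 = s S r C\<close>, \<open>l\<^sub>2 = s y B\<close>, \<open>l\<^sub>1 = S x A\<close> have the differences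
\<open>1, s, S, s S r, s y, S x\<close> (for \<open>ij = 12, 23, 13, 34, 24, 14\<close>), so each divides both members of its pair, and
\<open>l\<^sub>1 l\<^sub>2 l\<^sub>3 l\<^sub>4\<close> is \<open>s S z A B C\<close>, the product of the atoms 0 to 5, up to squares.\<close>

definition atom :: "int \<Rightarrow> int \<Rightarrow> int \<Rightarrow> nat \<Rightarrow> int" where
  "atom s r z i = [s, s + 1, z,
     s * r * ((s + 1) * r + 1) * z + 1,
     (s + 1) * r * (s * r + 1) * z + 1,
     (s * r + 1) * ((s + 1) * r + 1) * z + 1,
     r, s * r + 1, (s + 1) * r + 1] ! i"

lemma atom_simps [simp]:
  "atom s r z 0 = s" "atom s r z (Suc 0) = s + 1" "atom s r z 2 = z"
  "atom s r z 3 = s * r * ((s + 1) * r + 1) * z + 1"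
  "atom s r z 4 = (s + 1) * r * (s * r + 1) * z + 1"
  "atom s r z 5 = (s * r + 1) * ((s + 1) * r + 1) * z + 1"
  "atom s r z 6 = r" "atom s r z 7 = s * r + 1" "atom s r z 8 = (s + 1) * r + 1"
  by (simp_all add: atom_def)

lemma less_6_cases: "i < 6 \<Longrightarrow> i = 0 \<or> i = Suc 0 \<or> i = 2 \<or> i = 3 \<or> i = 4 \<or> i = (5::nat)"
  by auto

lemma less_9_cases: "i < 9 \<Longrightarrow> i < 6 \<or> i = 6 \<or> i = 7 \<or> i = (8::nat)"
  by auto

lemma atom_cong:
  assumes "[s = s'] (mod m)" "[r = r'] (mod m)" "[z = z'] (mod m)" "i < 9"
  shows "[atom s r z i = atom s' r' z' i] (mod m)"
  using less_9_cases[OF assms(4)] less_6_cases[of i]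
  by (elim disjE) (auto intro!: cong_add cong_mult assms(1-3))

text \<open>The modulus is \<open>p\<^sup>2\<close> rather than \<open>p\<close> because some atom
  has to be divisible by \<open>p\<close> exactly once. Residue classes at different primes can be
  combined by the Chinese remainder theorem.\<close>

definition realizable :: "int \<Rightarrow> ((nat \<Rightarrow> int) \<Rightarrow> bool) \<Rightarrow> bool" where
  "realizable p Q \<longleftrightarrow> (\<exists>s0 r0 z0. \<forall>s r z. [s = s0] (mod p\<^sup>2) \<longrightarrow> [r = r0] (mod p\<^sup>2) \<longrightarrow>
     [z = z0] (mod p\<^sup>2) \<longrightarrow> Q (atom s r z))"

lemma cong_square_modulus: "[x = y] (mod p\<^sup>2) \<Longrightarrow> [x = y] (mod p)" for p :: int
  by (erule cong_dvd_modulus) simp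

lemma isolatesI:
  assumes p: "prime p" and k: "[f k = p] (mod p\<^sup>2)" and i: "\<And>i. i < m \<Longrightarrow> i \<noteq> k \<Longrightarrow> \<not> p dvd f i"
  shows "isolates p f m k"
proof -
  have "p dvd f k" using cong_square_modulus[OF k] by (simp add: cong_dvd_iff)
  moreover have "\<not> p\<^sup>2 dvd f k"
  proof
    assume "p\<^sup>2 dvd f k"
    then have "p\<^sup>2 dvd p" using k by (simp add: cong_dvd_iff)
    then have "p\<^sup>2 \<le> p" using prime_gt_0_int[OF p] zdvd_imp_le by blast
    then show False using prime_gt_1_int[OF p] by (simp add: power2_eq_square)
  qed
  ultimately have "multiplicity p (f k) = 1" by (intro multiplicity_eqI) (auto simp: power2_eq_square)
  then show ?thesis using p i by (simp add: isolates_def)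
qed

lemma not_dvd_small: "x \<noteq> 0 \<Longrightarrow> \<bar>x\<bar> < p \<Longrightarrow> \<not> p dvd x" for p x :: int
  using zdvd_imp_le[of p "\<bar>x\<bar>"] by auto

text \<open>The first triple makes atom \<open>k\<close> equal to \<open>p\<close> itself. The
  second is a small representative of it modulo \<open>p\<close>, at which the other atoms are
  nonzero and less than 100 in absolute value, hence prime to \<open>p\<close>.\<close>

lemma realizable_isolates:
  assumes p: "prime p" "p > 100" and k: "atom s0 r0 z0 k = p" "k < 9" "m \<le> 9"
    and c: "[s0 = s1] (mod p)" "[r0 = r1] (mod p)" "[z0 = z1] (mod p)"
    and small: "\<forall>i<m. i \<noteq> k \<longrightarrow> atom s1 r1 z1 i \<noteq> 0 \<and> \<bar>atom s1 r1 z1 i\<bar> < 100"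
  shows "realizable p (\<lambda>f. \<exists>p. isolates p f m k)"
  unfolding realizable_def
proof (intro exI allI impI)
  fix s r z assume a: "[s = s0] (mod p\<^sup>2)" "[r = r0] (mod p\<^sup>2)" "[z = z0] (mod p\<^sup>2)"
  show "isolates p (atom s r z) m k"
  proof (rule isolatesI[OF p(1)])
    show "[atom s r z k = p] (mod p\<^sup>2)" using atom_cong[OF a k(2)] k(1) by simp
    fix i assume i: "i < m" "i \<noteq> k"
    have "[atom s r z i = atom s1 r1 z1 i] (mod p)"
      by (rule atom_cong) (use a[THEN cong_square_modulus] c i k in \<open>auto intro: cong_trans\<close>)
    moreover have "\<not> p dvd atom s1 r1 z1 i"
      by (rule not_dvd_small) (use small i p(2) in \<open>force+\<close>)
    ultimately show "\<not> p dvd atom s r z i" by (simp add: cong_dvd_iff)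
  qed
qed

lemma ex_quotient_mod_square:
  fixes p c b :: int
  assumes "prime p" "\<not> p dvd c"
  shows "\<exists>x. [c * x = b] (mod p\<^sup>2)"
proof -
  have "coprime p c" using assms by (simp add: prime_imp_coprime)
  then have "coprime c (p\<^sup>2)" by (simp add: coprime_commute)
  then obtain x where "[c * x = 1] (mod p\<^sup>2)" using cong_solve_coprime_int by blast
  then have "[c * x * b = 1 * b] (mod p\<^sup>2)" by (rule cong_scalar_right)
  then show ?thesis by (intro exI[of _ "x * b"]) (simp add: mult.assoc)
qed

lemma local_signsI:
  assumes p: "prime p" "p mod 4 = 3" and k: "[f k = p] (mod p\<^sup>2)"
    and i: "\<And>i. i < m \<Longrightarrow> i \<noteq> k \<Longrightarrow> [f i ^ nat (p div 2) = (if i \<in> V then -1 else 1)] (mod p)"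
  shows "local_signs f m k V"
  unfolding local_signs_def
proof (intro exI conjI allI impI)
  have e: "nat (p div 2) > 0" using odd_half_3_mod_4 p prime_gt_0_int by (blast intro: odd_pos)
  show "isolates p f m k"
  proof (rule isolatesI)
    show "prime p" "[f k = p] (mod p\<^sup>2)" by (rule p k)+
    fix i assume a: "i < m" "i \<noteq> k"
    show "\<not> p dvd f i"
    proof
      assume "p dvd f i"
      then have "p dvd f i ^ nat (p div 2)" using dvd_power[of "nat (p div 2)" "f i"] e by (metis dvd_trans)
      then have "p dvd (if i \<in> V then -1 else 1)" using i[OF a] by (simp add: cong_dvd_iff)
      then show False using p(1) by (auto split: if_splits)
    qed
  qed
qed (use p i in auto)

text \<open>The Pythagorean triples \<open>(c, d, d')\<close> serve to make both \<open>s\<close> and \<open>s + 1\<close> squares up to sign.\<close>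

lemma realizable_local_z:
  fixes p c d d' \<sigma> \<tau> :: int
  assumes p: "prime p" "p mod 4 = 3" "p > 100" and V: "V \<subseteq> {0, Suc 0}"
    and num: "\<sigma> \<in> {1, -1}" "\<tau> \<in> {1, -1}" "\<sigma> * d\<^sup>2 + c\<^sup>2 = \<tau> * d'\<^sup>2" "(0 \<in> V) = (\<sigma> = -1)" "(Suc 0 \<in> V) = (\<tau> = -1)"
    and cd: "c \<in> {1..<100}" "d \<in> {1..<100}" "d' \<in> {1..<100}"
  shows "realizable p (\<lambda>f. local_signs f 6 2 V)"
proof -
  have nd: "\<not> p dvd c" "\<not> p dvd d" "\<not> p dvd d'" "\<not> p dvd 1" using cd p(3) by (intro not_dvd_small; simp)+
  have "\<not> p dvd c\<^sup>2" using nd(1) p(1) prime_dvd_power by blast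
  then obtain s0 where s0: "[c\<^sup>2 * s0 = \<sigma> * d\<^sup>2] (mod p\<^sup>2)" using ex_quotient_mod_square[OF p(1)] by blast
  show ?thesis
    unfolding realizable_def
  proof (intro exI allI impI)
    \<comment> \<open>With r and z zero modulo \<open>p\<close>, the atoms 3, 4, 5 are 1, so only s
      and s + 1 carry signs; z = p modulo \<open>p\<^sup>2\<close> makes \<open>p\<close> divide
      atom 2 exactly once.\<close>
    fix s r z assume a: "[s = s0] (mod p\<^sup>2)" "[r = 0] (mod p\<^sup>2)" "[z = p] (mod p\<^sup>2)"
    have "[c\<^sup>2 * s = c\<^sup>2 * s0] (mod p\<^sup>2)" by (intro cong_mult cong_refl a)
    then have s: "[c\<^sup>2 * s = \<sigma> * d\<^sup>2] (mod p)" using s0 by (blast intro: cong_trans cong_square_modulus)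
    have "[c\<^sup>2 * s + c\<^sup>2 = \<sigma> * d\<^sup>2 + c\<^sup>2] (mod p)" by (intro cong_add s cong_refl)
    then have s': "[c\<^sup>2 * (s + 1) = \<tau> * d'\<^sup>2] (mod p)" unfolding num(3) by (simp add: algebra_simps)
    have z: "[z = 0] (mod p)" using cong_square_modulus[OF a(3)] by (simp add: Cong.cong_def)
    show "local_signs (atom s r z) 6 2 V"
    proof (rule local_signsI[OF p(1,2)])
      show "[atom s r z 2 = p] (mod p\<^sup>2)" using a by simp
      fix i :: nat assume i: "i < 6" "i \<noteq> 2"
      have 0: "[atom s r z i = atom s r 0 i] (mod p)" by (rule atom_cong) (use z i in auto)
      have "[atom s r z i ^ nat (p div 2) = 1] (mod p)" if "atom s r 0 i = 1"
        using cong_pow[OF 0, of "nat (p div 2)"] that by simp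
      moreover have "[s ^ nat (p div 2) = \<sigma>] (mod p)" "[(s + 1) ^ nat (p div 2) = \<tau>] (mod p)"
        using quadratic_sign[OF p(1,2) _ nd(1) _ s] quadratic_sign[OF p(1,2) _ nd(1) _ s'] num nd by auto
      ultimately show "[atom s r z i ^ nat (p div 2) = (if i \<in> V then -1 else 1)] (mod p)"
        using less_6_cases[OF i(1)] i(2) V num(1,2,4,5) by (elim disjE) auto
    qed
  qed
qed

text \<open>Modulo \<open>p\<close> we have \<open>r = -1\<close> and \<open>z = -1 / s\<^sup>2\<close>, hence \<open>B = 1 / s\<^sup>2\<close> and \<open>C = 1 / s\<close>.\<close>

lemma realizable_local_A:
  fixes p c d d' \<tau> :: int
  assumes p: "prime p" "p mod 4 = 3" "p > 100" and V: "V = {0, 2, 5} \<union> (if \<tau> = -1 then {Suc 0} else {})"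
    and num: "\<tau> \<in> {1, -1}" "c\<^sup>2 - d\<^sup>2 = \<tau> * d'\<^sup>2"
    and cd: "c \<in> {1..<100}" "d \<in> {1..<100}" "d' \<in> {1..<100}"
  shows "realizable p (\<lambda>f. local_signs f 6 3 V)"
proof -
  have nd: "\<not> p dvd c" "\<not> p dvd d" "\<not> p dvd d'" "\<not> p dvd 1" using cd p(3) by (intro not_dvd_small; simp)+
  have "\<not> p dvd c\<^sup>2" using nd(1) p(1) prime_dvd_power by blast
  then obtain s0 where s0: "[c\<^sup>2 * s0 = -1 * d\<^sup>2] (mod p\<^sup>2)" using ex_quotient_mod_square[OF p(1)] by blast
  have "\<not> p dvd s0"
  proof
    assume "p dvd s0"
    then have "p dvd -1 * d\<^sup>2" using cong_dvd_iff[OF cong_square_modulus[OF s0]] by simp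
    then show False using nd(2) p(1) prime_dvd_power by auto
  qed
  then have "\<not> p dvd s0\<^sup>2" using p(1) prime_dvd_power by blast
  \<comment> \<open>The value is p - 1 in place of -1: for r = -1 atom 3 is
    \<open>s\<^sup>2 * z + 1\<close>, and it has to be p, not 0, modulo
    \<open>p\<^sup>2\<close>.\<close>
  then obtain z0 where z0: "[s0\<^sup>2 * z0 = p - 1] (mod p\<^sup>2)" using ex_quotient_mod_square[OF p(1)] by blast
  show ?thesis
    unfolding realizable_def
  proof (intro exI allI impI)
    fix s r z assume a: "[s = s0] (mod p\<^sup>2)" "[r = -1] (mod p\<^sup>2)" "[z = z0] (mod p\<^sup>2)"
    have "[c\<^sup>2 * s = c\<^sup>2 * s0] (mod p\<^sup>2)" by (intro cong_mult cong_refl a)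
    then have s: "[c\<^sup>2 * s = -1 * d\<^sup>2] (mod p)" using s0 by (blast intro: cong_trans cong_square_modulus)
    have "[c\<^sup>2 * s + c\<^sup>2 = -1 * d\<^sup>2 + c\<^sup>2] (mod p)" by (intro cong_add s cong_refl)
    moreover have "-1 * d\<^sup>2 + c\<^sup>2 = \<tau> * d'\<^sup>2" using num by simp
    ultimately have s': "[c\<^sup>2 * (s + 1) = \<tau> * d'\<^sup>2] (mod p)" by (simp add: algebra_simps)
    have "[s\<^sup>2 * z = s0\<^sup>2 * z0] (mod p\<^sup>2)" by (intro cong_mult cong_pow a)
    then have sz: "[s\<^sup>2 * z = p - 1] (mod p\<^sup>2)" using z0 by (rule cong_trans)
    then have sz': "[s\<^sup>2 * z = -1] (mod p)"
      using cong_square_modulus[OF sz] cong_diff[of p 0 p 1 1] by (auto simp: cong_0_iff intro: cong_trans)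
    have ps: "\<not> p dvd s" using cong_dvd_iff[OF cong_square_modulus[OF a(1)]] \<open>\<not> p dvd s0\<close> by simp
    have pcs: "\<not> p dvd c * s" using ps nd(1) p(1) by (simp add: prime_dvd_mult_iff)
    have at: "[atom s r z i = atom s (-1) z i] (mod p\<^sup>2)" if "i < 9" for i
      by (rule atom_cong) (use a that in auto)
    note at' = at[THEN cong_square_modulus]
    note sign = quadratic_sign[OF p(1,2)]
    show "local_signs (atom s r z) 6 3 V"
    proof (rule local_signsI[OF p(1,2)])
      have "atom s (-1) z 3 = s\<^sup>2 * z + 1" by (simp add: algebra_simps power2_eq_square)
      moreover have "[s\<^sup>2 * z + 1 = p - 1 + 1] (mod p\<^sup>2)" by (intro cong_add sz cong_refl)
      ultimately show "[atom s r z 3 = p] (mod p\<^sup>2)" using at[of 3] by (auto intro: cong_trans)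
      fix i :: nat assume i: "i < 6" "i \<noteq> 3"
      have "[z ^ nat (p div 2) = -1] (mod p)"
        by (rule sign[of "-1" s 1]) (use ps nd sz' in auto)
      moreover have "[s ^ nat (p div 2) = -1] (mod p)"
        by (rule sign[of "-1" c d]) (use nd s in auto)
      moreover have "[(s + 1) ^ nat (p div 2) = \<tau>] (mod p)"
        by (rule sign[of _ c d']) (use nd s' num in auto)
      moreover have "[atom s r z 4 ^ nat (p div 2) = 1] (mod p)"
      proof (rule sign[of 1 s 1])
        have "[s\<^sup>2 * atom s r z 4 = s\<^sup>2 * atom s (-1) z 4] (mod p)" by (intro cong_mult cong_refl at') simp
        also have "s\<^sup>2 * atom s (-1) z 4 = (s\<^sup>2 - 1) * (s\<^sup>2 * z) + s\<^sup>2" by (simp add: algebra_simps power2_eq_square)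
        also have "[(s\<^sup>2 - 1) * (s\<^sup>2 * z) + s\<^sup>2 = (s\<^sup>2 - 1) * (-1) + s\<^sup>2] (mod p)"
          by (intro cong_mult cong_add cong_refl sz')
        finally show "[s\<^sup>2 * atom s r z 4 = 1 * 1\<^sup>2] (mod p)" by simp
      qed (use ps nd in auto)
      moreover have "[atom s r z 5 ^ nat (p div 2) = -1] (mod p)"
      proof (rule sign[of "-1" "c * s" d])
        have "[(c * s)\<^sup>2 * atom s r z 5 = (c * s)\<^sup>2 * atom s (-1) z 5] (mod p)" by (intro cong_mult cong_refl at') simp
        also have "(c * s)\<^sup>2 * atom s (-1) z 5 = c\<^sup>2 * ((s\<^sup>2 - s) * (s\<^sup>2 * z) + s\<^sup>2)"
          by (simp add: algebra_simps power2_eq_square)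
        also have "[c\<^sup>2 * ((s\<^sup>2 - s) * (s\<^sup>2 * z) + s\<^sup>2) = c\<^sup>2 * ((s\<^sup>2 - s) * (-1) + s\<^sup>2)] (mod p)"
          by (intro cong_mult cong_add cong_refl sz')
        also have "c\<^sup>2 * ((s\<^sup>2 - s) * (-1) + s\<^sup>2) = c\<^sup>2 * s" by (simp add: algebra_simps)
        also note s
        finally show "[(c * s)\<^sup>2 * atom s r z 5 = -1 * d\<^sup>2] (mod p)" .
      qed (use pcs nd in auto)
      ultimately show "[atom s r z i ^ nat (p div 2) = (if i \<in> V then -1 else 1)] (mod p)"
        using less_6_cases[OF i(1)] i(2) num(1) unfolding V by (elim disjE) (auto simp del: atom_simps(4-6))
    qed
  qed
qed

text \<open>Modulo \<open>p\<close> we have \<open>r = 1\<close>, \<open>s = 9 / 16\<close> and \<open>z = -1 / (s + 1)\<^sup>2\<close>, hence \<open>A = 1 / (s + 1)\<^sup>2\<close>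
and \<open>C = -1 / (s + 1)\<close>.\<close>

lemma realizable_local_B:
  assumes p: "prime p" "p mod 4 = 3" "p > 100"
  shows "realizable p (\<lambda>f. local_signs f 6 4 {2, 5})"
proof -
  have nd: "\<not> p dvd 4" "\<not> p dvd 3" "\<not> p dvd 5" "\<not> p dvd 1" "\<not> p dvd 4\<^sup>2" "\<not> p dvd 25"
    using p(3) by (intro not_dvd_small; simp)+
  \<comment> \<open>The fraction 9 / 16 is chosen because it and 9 / 16 + 1 = 25 / 16 are both
    squares.\<close>
  obtain s0 where s0: "[4\<^sup>2 * s0 = 3\<^sup>2] (mod p\<^sup>2)" using ex_quotient_mod_square[OF p(1)] nd by blast
  have s0': "[4\<^sup>2 * (s0 + 1) = 5\<^sup>2] (mod p\<^sup>2)"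
    using cong_add[OF s0 cong_refl[of "4\<^sup>2"]] by (simp add: algebra_simps)
  have pt0: "\<not> p dvd s0 + 1"
  proof
    assume "p dvd s0 + 1"
    then have "p dvd 4\<^sup>2 * (s0 + 1)" by (rule dvd_mult)
    then have "p dvd 5\<^sup>2" using cong_dvd_iff[OF cong_square_modulus[OF s0']] by blast
    then show False using nd by simp
  qed
  then have "\<not> p dvd (s0 + 1)\<^sup>2" using p(1) prime_dvd_power by blast
  then obtain z0 where z0: "[(s0 + 1)\<^sup>2 * z0 = p - 1] (mod p\<^sup>2)" using ex_quotient_mod_square[OF p(1)] by blast
  show ?thesis
    unfolding realizable_def
  proof (intro exI allI impI)
    fix s r z assume a: "[s = s0] (mod p\<^sup>2)" "[r = 1] (mod p\<^sup>2)" "[z = z0] (mod p\<^sup>2)"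
    define t where "t = s + 1"
    have at1: "[t = s0 + 1] (mod p\<^sup>2)" unfolding t_def by (intro cong_add a cong_refl)
    have "[4\<^sup>2 * s = 4\<^sup>2 * s0] (mod p\<^sup>2)" by (intro cong_mult cong_refl a)
    then have s: "[4\<^sup>2 * s = 1 * 3\<^sup>2] (mod p)" using s0 by (auto intro: cong_trans cong_square_modulus)
    have "[4\<^sup>2 * t = 4\<^sup>2 * (s0 + 1)] (mod p\<^sup>2)" by (intro cong_mult cong_refl at1)
    then have s': "[4\<^sup>2 * t = 1 * 5\<^sup>2] (mod p)" using s0' by (metis cong_trans cong_square_modulus mult_1)
    have "[t\<^sup>2 * z = (s0 + 1)\<^sup>2 * z0] (mod p\<^sup>2)" by (intro cong_mult cong_pow a at1)
    then have sz: "[t\<^sup>2 * z = p - 1] (mod p\<^sup>2)" using z0 by (rule cong_trans)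
    then have sz': "[t\<^sup>2 * z = -1] (mod p)"
      using cong_square_modulus[OF sz] cong_diff[of p 0 p 1 1] by (auto simp: cong_0_iff intro: cong_trans)
    have ps: "\<not> p dvd t" using cong_dvd_iff[OF cong_square_modulus[OF at1]] pt0 by simp
    have pcs: "\<not> p dvd 4 * t" using ps nd(1) p(1) by (simp add: prime_dvd_mult_iff)
    have at: "[atom s r z i = atom s 1 z i] (mod p\<^sup>2)" if "i < 9" for i
      by (rule atom_cong) (use a that in auto)
    note at' = at[THEN cong_square_modulus]
    note sign = quadratic_sign[OF p(1,2)]
    show "local_signs (atom s r z) 6 4 {2, 5}"
    proof (rule local_signsI[OF p(1,2)])
      have "atom s 1 z 4 = t\<^sup>2 * z + 1" by (simp add: t_def algebra_simps power2_eq_square)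
      moreover have "[t\<^sup>2 * z + 1 = p - 1 + 1] (mod p\<^sup>2)" by (intro cong_add sz cong_refl)
      ultimately show "[atom s r z 4 = p] (mod p\<^sup>2)" using at[of 4] by (auto intro: cong_trans)
      fix i :: nat assume i: "i < 6" "i \<noteq> 4"
      have "[z ^ nat (p div 2) = -1] (mod p)"
        by (rule sign[of "-1" t 1]) (use ps nd sz' in auto)
      moreover have "[s ^ nat (p div 2) = 1] (mod p)"
        by (rule sign[of 1 4 3]) (use nd s in auto)
      moreover have "[t ^ nat (p div 2) = 1] (mod p)"
        by (rule sign[of 1 4 5]) (use nd s' in auto)
      moreover have "[atom s r z 3 ^ nat (p div 2) = 1] (mod p)"
      proof (rule sign[of 1 t 1])
        have "[t\<^sup>2 * atom s r z 3 = t\<^sup>2 * atom s 1 z 3] (mod p)" by (intro cong_mult cong_refl at') simp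
        also have "t\<^sup>2 * atom s 1 z 3 = (t\<^sup>2 - 1) * (t\<^sup>2 * z) + t\<^sup>2" by (simp add: t_def algebra_simps power2_eq_square)
        also have "[(t\<^sup>2 - 1) * (t\<^sup>2 * z) + t\<^sup>2 = (t\<^sup>2 - 1) * (-1) + t\<^sup>2] (mod p)"
          by (intro cong_mult cong_add cong_refl sz')
        finally show "[t\<^sup>2 * atom s r z 3 = 1 * 1\<^sup>2] (mod p)" by simp
      qed (use ps nd in auto)
      moreover have "[atom s r z 5 ^ nat (p div 2) = -1] (mod p)"
      proof (rule sign[of "-1" "4 * t" 5])
        have "[(4 * t)\<^sup>2 * atom s r z 5 = (4 * t)\<^sup>2 * atom s 1 z 5] (mod p)" by (intro cong_mult cong_refl at') simp
        also have "(4 * t)\<^sup>2 * atom s 1 z 5 = 4\<^sup>2 * ((t\<^sup>2 + t) * (t\<^sup>2 * z) + t\<^sup>2)"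
          by (simp add: t_def algebra_simps power2_eq_square)
        also have "[4\<^sup>2 * ((t\<^sup>2 + t) * (t\<^sup>2 * z) + t\<^sup>2) = 4\<^sup>2 * ((t\<^sup>2 + t) * (-1) + t\<^sup>2)] (mod p)"
          by (intro cong_mult cong_add cong_refl sz')
        also have "4\<^sup>2 * ((t\<^sup>2 + t) * (-1) + t\<^sup>2) = -1 * (4\<^sup>2 * t)" by (simp add: algebra_simps)
        also have "[-1 * (4\<^sup>2 * t) = -1 * (1 * 5\<^sup>2)] (mod p)" by (intro cong_mult cong_refl s')
        finally show "[(4 * t)\<^sup>2 * atom s r z 5 = -1 * 5\<^sup>2] (mod p)" by simp
      qed (use pcs nd in auto)
      ultimately show "[atom s r z i ^ nat (p div 2) = (if i \<in> {2, 5} then -1 else 1)] (mod p)"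
        using less_6_cases[OF i(1)] i(2) unfolding t_def by (elim disjE) (auto simp del: atom_simps(4-6))
    qed
  qed
qed

text \<open>Every condition receives its own prime above \<open>K\<close>, so the moduli
  \<open>(P j)\<^sup>2\<close> and \<open>K ^ 3\<close> are pairwise coprime. The residue
  \<open>K\<^sup>2\<close> modulo \<open>K ^ 3\<close> means \<open>K\<^sup>2\<close> times a number
  that is 1 modulo \<open>K\<close>, so that the primes of \<open>K\<close> get even
  multiplicity.\<close>

lemma ex_atoms:
  fixes Q :: "nat \<Rightarrow> (nat \<Rightarrow> int) \<Rightarrow> bool" and K :: int
  assumes Q: "\<And>j p. j < n \<Longrightarrow> prime p \<Longrightarrow> p mod 4 = 3 \<Longrightarrow> p > 100 \<Longrightarrow> realizable p (Q j)"
    and K: "K > 1"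
  shows "\<exists>s r z. s > 0 \<and> r > 0 \<and> z > 0 \<and> [s = K\<^sup>2] (mod K^3) \<and> [r = K\<^sup>2] (mod K^3) \<and>
    [z = K\<^sup>2] (mod K^3) \<and> (\<forall>j<n. Q j (atom s r z))"
proof -
  define X where "X = {p :: int. prime p \<and> p mod 4 = 3 \<and> p > max K 100}"
  have "infinite X"
  proof
    assume fin: "finite X"
    obtain p where p: "prime p" "p mod 4 = 3" "p > max (max K 100) (Max X)"
      using ex_prime_3_mod_4 by blast
    then have "p \<in> X" by (auto simp: X_def)
    then show False using Max_ge[OF fin, of p] p(3) by simp
  qed
  then obtain P :: "nat \<Rightarrow> int" where P: "inj P" "range P \<subseteq> X"
    using infinite_countable_subset by blast
  then have pr: "prime (P j)" "P j mod 4 = 3" "P j > 100" "P j > K" for j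
    by (auto simp: X_def image_subset_iff)
  have "\<forall>j. \<exists>s0 r0 z0. j < n \<longrightarrow> (\<forall>s r z. [s = s0] (mod (P j)\<^sup>2) \<longrightarrow> [r = r0] (mod (P j)\<^sup>2) \<longrightarrow>
     [z = z0] (mod (P j)\<^sup>2) \<longrightarrow> Q j (atom s r z))"
    using Q[OF _ pr(1-3)] unfolding realizable_def by blast
  then obtain s0 r0 z0 where res: "\<And>j s r z. j < n \<Longrightarrow> [s = s0 j] (mod (P j)\<^sup>2) \<Longrightarrow>
      [r = r0 j] (mod (P j)\<^sup>2) \<Longrightarrow> [z = z0 j] (mod (P j)\<^sup>2) \<Longrightarrow> Q j (atom s r z)"
    by metis
  \<comment> \<open>Index \<open>n\<close> is an extra slot for the modulus
    \<open>K ^ 3\<close>.\<close>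
  define m where "m j = (if j < n then (P j)\<^sup>2 else K ^ 3)" for j
  have m0: "m j > 0" for j using pr(3)[of j] K by (simp add: m_def)
  have cop: "coprime (m i) (m j)" if "i \<le> n" "j \<le> n" "i \<noteq> j" for i j
  proof -
    have PK: "coprime (P i) K" for i
    proof (rule prime_imp_coprime[OF pr(1)])
      show "\<not> P i dvd K" using zdvd_imp_le[of "P i" K] pr(4)[of i] K by auto
    qed
    have "P i \<noteq> P j" using P(1) that(3) by (auto dest: injD)
    then have "coprime (P i) (P j)" using pr(1) by (intro primes_coprime)
    then show ?thesis using that PK[of i] PK[of j] by (auto simp: m_def coprime_commute)
  qed
  have CRT: "\<exists>x>0. [x = K\<^sup>2] (mod K ^ 3) \<and> (\<forall>j<n. [x = \<rho> j] (mod (P j)\<^sup>2))" for \<rho>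
  proof -
    define \<rho>' where "\<rho>' j = (if j < n then \<rho> j else K\<^sup>2)" for j
    have "\<forall>i\<in>{..n}. \<forall>j\<in>{..n}. i \<noteq> j \<longrightarrow> coprime (nat (m i)) (nat (m j))"
      using cop m0 by (auto simp: coprime_int_iff[symmetric] less_imp_le simp del: coprime_int_iff)
    from chinese_remainder_nat[OF finite_atMost this, of "\<lambda>j. nat (\<rho>' j mod m j)"]
    obtain x where x: "\<And>j. j \<le> n \<Longrightarrow> [x = nat (\<rho>' j mod m j)] (mod nat (m j))" by auto
    have xj: "[int x = \<rho>' j] (mod m j)" if "j \<le> n" for j
    proof -
      have "[int x = int (nat (\<rho>' j mod m j))] (mod int (nat (m j)))" using x[OF that] by (simp only: cong_int_iff)
      then have "[int x = \<rho>' j mod m j] (mod m j)" using m0[of j] by simp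
      then show ?thesis by (simp add: Cong.cong_def)
    qed
    have "int x \<noteq> 0"
    proof
      assume "int x = 0"
      then have "K ^ 3 dvd K\<^sup>2" using xj[of n] by (simp add: \<rho>'_def m_def cong_iff_dvd_diff)
      then have "K ^ 3 \<le> K\<^sup>2" using K by (intro zdvd_imp_le) auto
      then show False using K power_strict_increasing[of 2 3 K] by simp
    qed
    moreover have "[int x = \<rho> j] (mod (P j)\<^sup>2)" if "j < n" for j
      using xj[of j] that by (simp add: \<rho>'_def m_def)
    ultimately show ?thesis using xj[of n] by (intro exI[of _ "int x"]) (simp add: \<rho>'_def m_def)
  qed
  obtain s where "s > 0" "[s = K\<^sup>2] (mod K ^ 3)" "\<And>j. j < n \<Longrightarrow> [s = s0 j] (mod (P j)\<^sup>2)" using CRT[of s0] by blast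
  moreover obtain r where "r > 0" "[r = K\<^sup>2] (mod K ^ 3)" "\<And>j. j < n \<Longrightarrow> [r = r0 j] (mod (P j)\<^sup>2)" using CRT[of r0] by blast
  moreover obtain z where "z > 0" "[z = K\<^sup>2] (mod K ^ 3)" "\<And>j. j < n \<Longrightarrow> [z = z0 j] (mod (P j)\<^sup>2)" using CRT[of z0] by blast
  ultimately show ?thesis using res by blast
qed

lemma ex_conditioned_atoms:
  fixes K :: int
  assumes K: "K > 1"
  shows "\<exists>s r z. s > 0 \<and> r > 0 \<and> z > 0 \<and> [s = K\<^sup>2] (mod K^3) \<and> [r = K\<^sup>2] (mod K^3) \<and>
    [z = K\<^sup>2] (mod K^3) \<and>
    (\<forall>k\<in>{6,7,8}. \<exists>p. isolates p (atom s r z) 9 k) \<and> (\<forall>k\<in>{0,1,5}. \<exists>p. isolates p (atom s r z) 6 k) \<and>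
    local_signs (atom s r z) 6 2 {0} \<and> local_signs (atom s r z) 6 2 {0,1} \<and> local_signs (atom s r z) 6 2 {} \<and>
    local_signs (atom s r z) 6 3 {0,2,5} \<and> local_signs (atom s r z) 6 3 {0,1,2,5} \<and> local_signs (atom s r z) 6 4 {2,5}"
proof -
  define Q :: "((nat \<Rightarrow> int) \<Rightarrow> bool) list" where "Q =
    [\<lambda>f. \<exists>p. isolates p f 9 6, \<lambda>f. \<exists>p. isolates p f 9 7, \<lambda>f. \<exists>p. isolates p f 9 8,
     \<lambda>f. \<exists>p. isolates p f 6 0, \<lambda>f. \<exists>p. isolates p f 6 1, \<lambda>f. \<exists>p. isolates p f 6 5,
     \<lambda>f. local_signs f 6 2 {0}, \<lambda>f. local_signs f 6 2 {0,1}, \<lambda>f. local_signs f 6 2 {},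
     \<lambda>f. local_signs f 6 3 {0,2,5}, \<lambda>f. local_signs f 6 3 {0,1,2,5}, \<lambda>f. local_signs f 6 4 {2,5}]"
  have real: "\<forall>q\<in>set Q. realizable p q" if p: "prime p" "p mod 4 = 3" "p > 100" for p
  proof -
    have all6: "(\<forall>i<6. R i) \<longleftrightarrow> R 0 \<and> R (Suc 0) \<and> R 2 \<and> R 3 \<and> R 4 \<and> R 5" for R :: "nat \<Rightarrow> bool"
      using less_6_cases by auto
    have all9: "(\<forall>i<9. R i) \<longleftrightarrow> (\<forall>i<6. R i) \<and> R 6 \<and> R 7 \<and> R 8" for R :: "nat \<Rightarrow> bool"
      using less_9_cases by auto
    have p0: "[p = 0] (mod p)" "[p - 1 = -1] (mod p)" "[1 - p = 1] (mod p)" by (simp_all add: cong_iff_dvd_diff)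
    \<comment> \<open>In each use the exact triple makes the target atom equal to p, for instance s
      r + 1 with s = 1 and r = p - 1 for atom 7. Negative values are harmless: only residues matter,
      and positive representatives are taken later.\<close>
    note iso = realizable_isolates[OF p(1,3)]
    have "realizable p (\<lambda>f. \<exists>p. isolates p f 9 6)"
      by (rule iso[of 1 p 1 6 9 1 0 1]) (use p0 in \<open>simp_all add: all9 all6\<close>)
    moreover have "realizable p (\<lambda>f. \<exists>p. isolates p f 9 7)"
      by (rule iso[of 1 "p - 1" 1 7 9 1 "-1" 1]) (use p0 in \<open>simp_all add: all9 all6\<close>)
    moreover have "realizable p (\<lambda>f. \<exists>p. isolates p f 9 8)"
      by (rule iso[of "-2" "1 - p" 1 8 9 "-2" 1 1]) (use p0 in \<open>simp_all add: all9 all6\<close>)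
    moreover have "realizable p (\<lambda>f. \<exists>p. isolates p f 6 0)"
      by (rule iso[of p 0 1 0 6 0 0 1]) (use p0 in \<open>simp_all add: all6\<close>)
    moreover have "realizable p (\<lambda>f. \<exists>p. isolates p f 6 1)"
      by (rule iso[of "p - 1" 0 1 1 6 "-1" 0 1]) (use p0 in \<open>simp_all add: all6\<close>)
    moreover have "realizable p (\<lambda>f. \<exists>p. isolates p f 6 5)"
      by (rule iso[of 1 0 "p - 1" 5 6 1 0 "-1"]) (use p0 in \<open>simp_all add: all6\<close>)
    moreover have "realizable p (\<lambda>f. local_signs f 6 2 {0})"
      by (rule realizable_local_z[OF p, where \<sigma> = "-1" and \<tau> = 1 and c = 5 and d = 3 and d' = 4]) auto
    moreover have "realizable p (\<lambda>f. local_signs f 6 2 {0,1})"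
      by (rule realizable_local_z[OF p, where \<sigma> = "-1" and \<tau> = "-1" and c = 4 and d = 5 and d' = 3]) auto
    moreover have "realizable p (\<lambda>f. local_signs f 6 2 {})"
      by (rule realizable_local_z[OF p, where \<sigma> = 1 and \<tau> = 1 and c = 4 and d = 3 and d' = 5]) auto
    moreover have "realizable p (\<lambda>f. local_signs f 6 3 {0,2,5})"
      by (rule realizable_local_A[OF p, where \<tau> = 1 and c = 5 and d = 3 and d' = 4]) auto
    moreover have "realizable p (\<lambda>f. local_signs f 6 3 {0,1,2,5})"
      by (rule realizable_local_A[OF p, where \<tau> = "-1" and c = 4 and d = 5 and d' = 3]) auto
    moreover note realizable_local_B[OF p]
    ultimately show ?thesis unfolding Q_def by simp
  qed
  then have "realizable p (Q ! j)" if "j < length Q" "prime p" "p mod 4 = 3" "p > 100" for j p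
    using that by simp
  from ex_atoms[of "length Q" "(!) Q", OF this K] obtain s r z where
    srz: "s > 0" "r > 0" "z > 0" "[s = K\<^sup>2] (mod K^3)" "[r = K\<^sup>2] (mod K^3)" "[z = K\<^sup>2] (mod K^3)"
    "\<And>j. j < length Q \<Longrightarrow> (Q ! j) (atom s r z)" by blast
  then have "\<forall>q\<in>set Q. q (atom s r z)" by (auto simp: in_set_conv_nth)
  then show ?thesis using srz unfolding Q_def by (intro exI[of _ s] exI[of _ r] exI[of _ z]) simp
qed

section \<open>Blocks of ten integers\<close>

text \<open>Entries 0 to 2 are the generators \<open>l\<^sub>1 l\<^sub>2\<close>, \<open>l\<^sub>1 l\<^sub>3\<close>, \<open>l\<^sub>1 l\<^sub>4\<close> with square factors removed; entries 3 to
8 are \<open>l\<^sub>i / (l\<^sub>i - l\<^sub>j)\<close> for \<open>ij = 12, 13, 23, 14, 24, 34\<close>, so that the first three of them only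
involve the first two generators.\<close>

definition monomial_support :: "nat \<Rightarrow> nat set" where
  "monomial_support i = [{0,1,3,4,7,8}, {0,3,5,6,7}, {0,2,3,6,8},
     {1,3,7}, {3,7}, {4,8}, {3}, {4}, {5}] ! i"

text \<open>Row j names the generators whose product has the class of the j-th
  \<open>n (n - 1)\<close>. Up to squares, \<open>l\<^sub>2 l\<^sub>3\<close> is
  \<open>l\<^sub>1 l\<^sub>2\<close> times \<open>l\<^sub>1 l\<^sub>3\<close>, and likewise for 24
  and 34; all three generators together give \<open>l\<^sub>1 l\<^sub>2 l\<^sub>3 l\<^sub>4\<close>,
  the row of \<open>a\<close>.\<close>

definition pell_relation :: "nat \<Rightarrow> nat set" where
  "pell_relation j = [{0}, {1}, {0,1}, {2}, {0,2}, {1,2}, {0,1,2}] ! j"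

definition pell_block :: "(nat \<Rightarrow> int) \<Rightarrow> bool" where
  "pell_block g \<longleftrightarrow> (\<forall>j<7. g (3 + j) > 1 \<and> (\<exists>w. g (3 + j) * (g (3 + j) - 1) * prod g (pell_relation j) = w\<^sup>2))"

text \<open>Primes up to \<open>N\<close> have even multiplicity in every entry. If no larger prime
  had odd multiplicity, the product would be a square, against the independence of the atoms and
  \<open>a\<close>.\<close>

lemma ex_pell_block:
  fixes N :: int
  shows "\<exists>g. pell_block g \<and> (\<forall>i<10. g i > 0) \<and>
    (\<forall>A\<subseteq>{..<10}. A \<noteq> {} \<longrightarrow> (\<exists>p. prime p \<and> p > N \<and> odd (multiplicity p (prod g A))))"
proof -
  \<comment> \<open>Divisible by every prime up to \<open>N\<close>, which gives the even
    multiplicities, and by 4, which gives the condition \<open>U mod 4 = 1\<close> needed for Pell's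
    equation.\<close>
  define K :: int where "K = 8 * fact (nat N)"
  have "fact (nat N) \<ge> (1 :: int)" by (rule fact_ge_1)
  then have K1: "K > 1" unfolding K_def by linarith
  have K4: "4 dvd K" by (simp add: K_def)
  have KN: "q dvd K" if "prime q" "q \<le> N" for q :: int
  proof -
    have q0: "q > 0" using that(1) by (rule prime_gt_0_int)
    then have "nat q dvd fact (nat N)" using that by (intro dvd_fact) auto
    then have "int (nat q) dvd int (fact (nat N))" by (simp only: int_dvd_int_iff)
    then show ?thesis using q0 by (simp add: K_def)
  qed
  obtain s r z where srz: "s > 0" "r > 0" "z > 0"
    "[s = K\<^sup>2] (mod K^3)" "[r = K\<^sup>2] (mod K^3)" "[z = K\<^sup>2] (mod K^3)"
    and iso: "\<forall>k\<in>{6,7,8}. \<exists>p. isolates p (atom s r z) 9 k" "\<forall>k\<in>{0,1,5}. \<exists>p. isolates p (atom s r z) 6 k"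
    and loc: "local_signs (atom s r z) 6 2 {0}" "local_signs (atom s r z) 6 2 {0,1}" "local_signs (atom s r z) 6 2 {}"
      "local_signs (atom s r z) 6 3 {0,2,5}" "local_signs (atom s r z) 6 3 {0,1,2,5}" "local_signs (atom s r z) 6 4 {2,5}"
    using ex_conditioned_atoms[OF K1] by blast
  define f where "f = atom s r z"
  have fpos: "f i > 0" if "i < 9" for i
    using less_9_cases[OF that] less_6_cases[of i] srz(1-3) unfolding f_def
    by (elim disjE) (auto intro!: add_pos_pos mult_pos_pos)
  have shape: "\<exists>y. x = K\<^sup>2 * y \<and> [y = 1] (mod K)" if "[x = K\<^sup>2] (mod K^3)" for x
  proof -
    have "K ^ 3 dvd x - K\<^sup>2" using that by (simp add: cong_iff_dvd_diff)
    then obtain c where "x - K\<^sup>2 = K ^ 3 * c" by (elim dvdE)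
    then have "x = K\<^sup>2 * (1 + K * c)" by (simp add: algebra_simps power2_eq_square power3_eq_cube)
    then show ?thesis by (intro exI[of _ "1 + K * c"]) (simp add: cong_iff_dvd_diff)
  qed
  obtain s' where s': "s = K\<^sup>2 * s'" "[s' = 1] (mod K)" using shape[OF srz(4)] by blast
  obtain r' where r': "r = K\<^sup>2 * r'" "[r' = 1] (mod K)" using shape[OF srz(5)] by blast
  obtain z' where z': "z = K\<^sup>2 * z'" "[z' = 1] (mod K)" using shape[OF srz(6)] by blast
  have K0: "[s = 0] (mod K)" "[r = 0] (mod K)" "[z = 0] (mod K)"
    by (simp_all add: s' r' z' cong_0_iff power2_eq_square)
  have one: "[f i = 1] (mod K)" if "i \<in> {1, 3, 4, 5, 7, 8}" for i
  proof -
    have "[f i = atom 0 0 0 i] (mod K)" unfolding f_def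
      by (rule atom_cong) (use K0 that in auto)
    then show ?thesis using that by auto
  qed
  \<comment> \<open>The atoms 0, 2, 6, that is s, z, r, are \<open>K\<^sup>2\<close> times a number
    that is 1 modulo \<open>K\<close>; all other atoms are themselves 1 modulo
    \<open>K\<close>.\<close>
  have even_atom: "even (multiplicity q (f i))" if q: "prime q" "q \<le> N" and i: "i < 9" for q i
  proof -
    have nd: "\<not> q dvd y" if "[y = 1] (mod K)" for y
    proof -
      have "[y = 1] (mod q)" by (rule cong_dvd_modulus[OF that KN[OF q]])
      then have "q dvd y \<longleftrightarrow> q dvd 1" by (rule cong_dvd_iff)
      then show ?thesis using prime_gt_1_int[OF q(1)] by simp
    qed
    have ev: "even (multiplicity q (K\<^sup>2 * y))" if "[y = 1] (mod K)" for y
    proof -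
      have "y \<noteq> 0" using nd[OF that] by auto
      then show ?thesis using K1 nd[OF that] even_multiplicity_square[OF q(1), of K]
        by (simp add: multiplicity_mult_int[OF q(1)] not_dvd_imp_multiplicity_0)
    qed
    consider "i = 0" | "i = 2" | "i = 6" | "i \<in> {1, 3, 4, 5, 7, 8}"
      using less_9_cases[OF i] less_6_cases[of i] by auto
    then show ?thesis
    proof cases
      case 4
      then show ?thesis using nd[OF one[OF 4]] by (simp add: not_dvd_imp_multiplicity_0)
    qed (use ev s' r' z' in \<open>simp_all add: f_def\<close>)
  qed
  define D where "D = prod f {..<6}"
  have Dpos: "D > 0" unfolding D_def using fpos by (intro prod_pos) auto
  \<comment> \<open>This is \<open>D\<close> without the square \<open>(K\<^sup>2)\<^sup>2\<close>
    contributed by \<open>s\<close> and \<open>z\<close>; every factor left is 1 modulo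
    \<open>K\<close>.\<close>
  define U where "U = s' * f 1 * z' * f 3 * f 4 * f 5"
  have lt6: "{..<6} = {0, 1, 2, 3, 4, 5 :: nat}" by auto
  have DU: "D = (K\<^sup>2)\<^sup>2 * U" unfolding D_def U_def lt6
    by (simp add: f_def s'(1) z'(1) power2_eq_square del: atom_simps(2-) add: atom_simps(3))
  have "[U = 1 * 1 * 1 * 1 * 1 * 1] (mod K)" unfolding U_def by (intro cong_mult s' z' one) auto
  then have U4: "U mod 4 = 1" using cong_dvd_modulus[OF _ K4, of U 1] by (simp add: Cong.cong_def)
  obtain pz where pz: "isolates pz f 6 2" using loc(1) unfolding local_signs_def f_def by blast
  have f0: "f i \<noteq> 0" if "i < 9" for i using fpos[OF that] by simp
  have "\<nexists>w. D = w\<^sup>2"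
  proof
    assume "\<exists>w. D = w\<^sup>2"
    then obtain w where w: "D = w\<^sup>2" by blast
    have "multiplicity pz D = 1" using isolates_multiplicity_prod[OF pz f0, of "{..<6}"] by (simp add: D_def)
    moreover have "w \<noteq> 0" using w Dpos by auto
    moreover have "prime pz" using pz by (simp add: isolates_def)
    ultimately show False using even_multiplicity_square[of pz w] w by simp
  qed
  moreover have "K\<^sup>2 \<noteq> 0" using K1 by simp
  ultimately obtain a v where a: "a > 1" "a * (a - 1) * D = v\<^sup>2" "\<nexists>b. a = b\<^sup>2"
    using nonsquare_pell_element[OF DU U4 _ Dpos] by blast
  have prod9: "(\<Prod>i<9. h i) = h 0 * h (Suc 0) * h 2 * h 3 * h 4 * h 5 * h 6 * h 7 * h 8" for h :: "nat \<Rightarrow> int"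
    by (simp add: numeral_eq_Suc)
  define E where "E i k = (of_bool (k \<in> monomial_support i) :: nat)" for i k
  define g where "g i = (if i = 9 then a else \<Prod>k<9. f k ^ E i k)" for i
  have gs: "g 0 = f 0 * f 1 * f 3 * f 4 * f 7 * f 8" "g 1 = f 0 * f 3 * f 5 * f 6 * f 7"
    "g 2 = f 0 * f 2 * f 3 * f 6 * f 8" "g 3 = f 1 * f 3 * f 7" "g 4 = f 3 * f 7" "g 5 = f 4 * f 8"
    "g 6 = f 3" "g 7 = f 4" "g 8 = f 5" "g 9 = a"
    by (simp_all add: g_def E_def monomial_support_def prod9)
  have gpos: "g i > 0" for i using a fpos by (auto simp: g_def intro!: prod_pos)
  \<comment> \<open>For n = \<open>l\<^sub>i / (l\<^sub>i - l\<^sub>j)\<close> one has n - 1 =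
    \<open>l\<^sub>j / (l\<^sub>i - l\<^sub>j)\<close>; the right-hand sides are these quotients in
    terms of atoms.\<close>
  have ident: "f 1 * f 3 * f 7 - 1 = f 0 * f 8 * f 4" "f 3 * f 7 - 1 = f 0 * f 6 * f 5"
    "f 4 * f 8 - 1 = f 1 * f 6 * f 5" "f 3 - 1 = f 0 * f 6 * f 8 * f 2" "f 4 - 1 = f 1 * f 6 * f 7 * f 2"
    "f 5 - 1 = f 7 * f 8 * f 2"
    by (simp_all add: f_def algebra_simps)
  \<comment> \<open>The product of the three generators has the class of \<open>D\<close>, so the
    equation solved by \<open>a\<close> is a relation of the required form.\<close>
  have Dg: "g 0 * g 1 * g 2 = D * (f 0 * f 6 * f 7 * f 8 * f 3)\<^sup>2"
    unfolding D_def lt6 by (simp add: gs power2_eq_square mult_ac del: One_nat_def)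
  have "pell_block g"
    unfolding pell_block_def
  proof (intro allI impI)
    fix j :: nat assume "j < 7"
    then consider "j = 0" | "j = 1" | "j = 2" | "j = 3" | "j = 4" | "j = 5" | "j = 6" by linarith
    then show "g (3 + j) > 1 \<and> (\<exists>w. g (3 + j) * (g (3 + j) - 1) * prod g (pell_relation j) = w\<^sup>2)"
    proof cases
      case 1
      have "f 1 * f 3 * f 7 - 1 > 0" unfolding ident by (intro mult_pos_pos fpos) auto
      moreover have "g 3 * (g 3 - 1) * g 0 = (g 0)\<^sup>2"
        unfolding gs ident by (simp add: power2_eq_square mult_ac)
      ultimately show ?thesis using 1 by (auto simp: pell_relation_def gs(4))
    next
      case 2
      have "f 3 * f 7 - 1 > 0" unfolding ident by (intro mult_pos_pos fpos) auto
      moreover have "g 4 * (g 4 - 1) * g 1 = (g 1)\<^sup>2"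
        unfolding gs ident by (simp add: power2_eq_square mult_ac)
      ultimately show ?thesis using 2 by (auto simp: pell_relation_def gs(5))
    next
      case 3
      have "f 4 * f 8 - 1 > 0" unfolding ident by (intro mult_pos_pos fpos) auto
      moreover have "g 5 * (g 5 - 1) * (g 0 * g 1) = (f 0 * f 7 * f 3 * f 8 * f 1 * f 4 * f 6 * f 5)\<^sup>2"
        unfolding gs ident by (simp add: power2_eq_square mult_ac)
      ultimately show ?thesis using 3 by (auto simp: pell_relation_def gs(6))
    next
      case 4
      have "f 3 - 1 > 0" unfolding ident by (intro mult_pos_pos fpos) auto
      moreover have "g 6 * (g 6 - 1) * g 2 = (g 2)\<^sup>2"
        unfolding gs ident by (simp add: power2_eq_square mult_ac)
      ultimately show ?thesis using 4 by (auto simp: pell_relation_def gs(7))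
    next
      case 5
      have "f 4 - 1 > 0" unfolding ident by (intro mult_pos_pos fpos) auto
      moreover have "g 7 * (g 7 - 1) * (g 0 * g 2) = (f 0 * f 1 * f 7 * f 8 * f 3 * f 4 * f 6 * f 2)\<^sup>2"
        unfolding gs ident by (simp add: power2_eq_square mult_ac)
      ultimately show ?thesis using 5 by (auto simp: pell_relation_def gs(8))
    next
      case 6
      have "f 5 - 1 > 0" unfolding ident by (intro mult_pos_pos fpos) auto
      moreover have "g 8 * (g 8 - 1) * (g 1 * g 2) = (f 0 * f 6 * f 3 * f 7 * f 8 * f 2 * f 5)\<^sup>2"
        unfolding gs ident by (simp add: power2_eq_square mult_ac)
      ultimately show ?thesis using 6 by (auto simp: pell_relation_def gs(9))
    next
      case 7
      have "g 9 * (g 9 - 1) * (g 0 * g 1 * g 2) = (v * (f 0 * f 6 * f 7 * f 8 * f 3))\<^sup>2"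
        unfolding Dg gs(10) power_mult_distrib[of v] a(2)[symmetric] by (simp add: mult_ac)
      then show ?thesis using 7 a(1) by (auto simp: pell_relation_def gs(10) mult.assoc)
    qed
  qed
  moreover have "\<exists>p. prime p \<and> p > N \<and> odd (multiplicity p (prod g A))" if A: "A \<subseteq> {..<10}" "A \<noteq> {}" for A
  proof (rule ccontr)
    assume contr: "\<nexists>p. prime p \<and> p > N \<and> odd (multiplicity p (prod g A))"
    have finA: "finite A" using A(1) finite_subset by blast
    have prodpos: "prod g A > 0" using gpos by (intro prod_pos) auto
    have small: "even (multiplicity p (g i))" if p: "prime p" "p \<le> N" for p i
    proof (cases "i = 9")
      case True
      have "multiplicity p D = (\<Sum>i<6. multiplicity p (f i))" unfolding D_def
        by (rule prime_elem_multiplicity_prod_distrib[OF prime_imp_prime_elem[OF p(1)]]) (use f0 in force)+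
      then have "even (multiplicity p D)" using even_atom[OF p] by (auto intro: dvd_sum)
      then show ?thesis using even_multiplicity_pell[OF p(1) a(1) _ a(2)] Dpos True by (simp add: g_def)
    next
      case False
      have "multiplicity p (\<Prod>k<9. f k ^ E i k) = (\<Sum>k<9. multiplicity p (f k ^ E i k))"
        by (rule prime_elem_multiplicity_prod_distrib[OF prime_imp_prime_elem[OF p(1)]]) (use f0 in force)+
      also have "\<dots> = (\<Sum>k<9. E i k * multiplicity p (f k))"
        using f0 p(1) by (intro sum.cong refl prime_elem_multiplicity_power_distrib) auto
      finally show ?thesis using False even_atom[OF p] by (auto simp: g_def intro!: dvd_sum)
    qed
    have "even (multiplicity p (prod g A))" if p: "prime p" for p
    proof (cases "p \<le> N")
      case True
      have "multiplicity p (prod g A) = (\<Sum>i\<in>A. multiplicity p (g i))"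
        by (rule prime_elem_multiplicity_prod_distrib[OF prime_imp_prime_elem[OF p] _ finA])
          (use gpos in \<open>force dest: less_imp_neq\<close>)
      then show ?thesis using small[OF p True] by (auto intro: dvd_sum)
    qed (use contr p in auto)
    then have "is_nth_power 2 (normalize (prod g A))"
      by (subst is_nth_power_conv_multiplicity) auto
    then obtain w where w: "prod g A = w\<^sup>2" using prodpos by (auto simp: is_nth_power_def)
    define \<iota> where "\<iota> i = (of_bool (i \<in> A) :: nat)" for i
    have "prod g A = (\<Prod>i<10. g i ^ \<iota> i)"
    proof -
      have "(\<Prod>i<10. g i ^ \<iota> i) = (\<Prod>i\<in>{..<10}. if i \<in> A then g i else 1)"
        by (intro prod.cong) (auto simp: \<iota>_def)
      also have "\<dots> = prod g ({..<10} \<inter> A)" by (simp add: prod.inter_restrict)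
      finally show ?thesis using A(1) by (simp add: Int_absorb1)
    qed
    also have "\<dots> = g 9 ^ \<iota> 9 * (\<Prod>i<9. g i ^ \<iota> i)"
    proof -
      have "{..<10} = insert 9 {..<9::nat}" by auto
      then show ?thesis by simp
    qed
    also have "(\<Prod>i<9. g i ^ \<iota> i) = (\<Prod>i<9. \<Prod>k<9. f k ^ (E i k * \<iota> i))"
      by (intro prod.cong) (auto simp: g_def power_mult prod_power_distrib)
    also have "\<dots> = (\<Prod>k<9. f k ^ (\<Sum>i<9. E i k * \<iota> i))"
      by (subst prod.swap) (simp add: power_sum)
    finally have sq: "a ^ \<iota> 9 * (\<Prod>k<9. f k ^ (\<Sum>i<9. E i k * \<iota> i)) = w\<^sup>2" using w by (simp add: g_def)
    have ev: "even (\<iota> 9) \<and> (\<forall>k<9. even (\<Sum>i<9. E i k * \<iota> i))"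
      by (rule atoms_independent[OF fpos a(1,3) a(2)[unfolded D_def] _ _ _ _ _ _ _ _ sq])
        (use iso loc in \<open>auto simp: f_def\<close>)
    have all9: "(\<forall>i<9. R i) \<longleftrightarrow> R 0 \<and> R (Suc 0) \<and> R 2 \<and> R 3 \<and> R 4 \<and> R 5 \<and> R 6 \<and> R 7 \<and> R 8" for R :: "nat \<Rightarrow> bool"
      using less_9_cases less_6_cases by (auto 4 4)
    have sum9: "(\<Sum>i<9. h i) = h 0 + h (Suc 0) + h 2 + h 3 + h 4 + h 5 + h 6 + h 7 + h 8" for h :: "nat \<Rightarrow> nat"
      by (simp add: numeral_eq_Suc)
    have \<iota>: "even (\<iota> i) \<longleftrightarrow> \<iota> i = 0" for i by (simp add: \<iota>_def)
    \<comment> \<open>The exponent matrix is invertible modulo 2: entries 6, 7, 8 are the atoms A,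
      B, C; entries 4, 5, 3 bring in x, y, S one at a time, and the generators 0, 1, 2 then bring in
      s, r, z.\<close>
    have "\<iota> 9 = 0 \<and> (\<forall>i<9. \<iota> i = 0)"
      using ev unfolding all9 sum9 by (auto simp: E_def monomial_support_def \<iota>)
    moreover have "i < 9 \<or> i = 9" if "i < 10" for i :: nat using that by linarith
    ultimately have "\<iota> i = 0" if "i < 10" for i using that by blast
    then show False using A by (auto simp: \<iota>_def)
  qed
  ultimately show ?thesis using gpos by blast
qed

text \<open>Each block contributes its first \<open>r\<close> generators and the first
  \<open>k\<close> entries of Pell type. The offset 3 in \<beta>, together with r \<le> 3, keeps the
  two index ranges disjoint, so the independence of the blocks covers \<open>d\<close> and
  \<open>n\<close> jointly.\<close>

lemma infinite_fields_from_blocks: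
  fixes r k t :: nat
  assumes r: "0 < r" "r \<le> 3" and k: "0 < k" "k \<le> 7" and t: "t > 0"
    and rel: "\<And>j. j < k \<Longrightarrow> pell_relation j \<subseteq> {..<r}"
  shows "infinite {L. real_multiquadratic L \<and> gal L \<cong> elem2_group (r * t) \<and>
            (\<exists>u. (\<forall>i<k * t. is_unit_of L (u i) \<and> totally_positive L (u i)) \<and>
                 indep_mod_squares L u (k * t))}"
proof -
  obtain g :: "nat \<Rightarrow> nat \<Rightarrow> int" where g: "\<And>b. pell_block (g b)" "\<And>b i. i < 10 \<Longrightarrow> g b i > 0"
    "\<And>A. finite A \<Longrightarrow> A \<noteq> {} \<Longrightarrow> A \<subseteq> UNIV \<times> {..<10} \<Longrightarrow> \<nexists>w. (\<Prod>(b, i)\<in>A. g b i) = w\<^sup>2"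
    using independent_blocks[of pell_block 10, OF ex_pell_block] by blast
  define \<alpha> where "\<alpha> i = (i div r, i mod r)" for i :: nat
  define \<beta> where "\<beta> j = (j div k, 3 + j mod k)" for j :: nat
  define d where "d i = (case \<alpha> i of (b, l) \<Rightarrow> g b l)" for i
  define n where "n j = (case \<beta> j of (b, l) \<Rightarrow> g b l)" for j
  have inj: "inj \<alpha>" "inj \<beta>"
    unfolding \<alpha>_def \<beta>_def by (auto intro!: injI) (metis div_mult_mod_eq)+
  have modr: "i mod r < 3" for i using r mod_less_divisor[of r i] by linarith
  have modk: "j mod k < 7" for j using k mod_less_divisor[of k j] by linarith
  show ?thesis
  proof (rule infinite_multiquadratic_fields[of d n r k t])
    show "d i > 0" for i using g(2)[of "i mod r"] modr[of i] by (simp add: d_def \<alpha>_def)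
    show "n j > 1" for j
      using g(1)[of "j div k"] modk[of j] by (simp add: n_def \<beta>_def pell_block_def)
    fix B C :: "nat set" assume BC: "finite B" "finite C" "B \<union> C \<noteq> {}"
    have disj: "\<alpha> ` B \<inter> \<beta> ` C = {}"
    proof -
      have "\<alpha> i \<noteq> \<beta> j" for i j using modr[of i] by (simp add: \<alpha>_def \<beta>_def)
      then show ?thesis by blast
    qed
    have "prod d B = (\<Prod>(b, i)\<in>\<alpha> ` B. g b i)" "prod n C = (\<Prod>(b, i)\<in>\<beta> ` C. g b i)"
      using inj by (simp_all add: prod.reindex inj_on_subset d_def n_def)
    then have "prod d B * prod n C = (\<Prod>(b, i)\<in>\<alpha> ` B \<union> \<beta> ` C. g b i)"
      using BC disj by (simp add: prod.union_disjoint)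
    moreover have "\<nexists>w. (\<Prod>(b, i)\<in>\<alpha> ` B \<union> \<beta> ` C. g b i) = w\<^sup>2"
    proof (rule g(3))
      have "\<alpha> i \<in> UNIV \<times> {..<10}" for i using modr[of i] by (simp add: \<alpha>_def)
      moreover have "\<beta> j \<in> UNIV \<times> {..<10}" for j using modk[of j] by (simp add: \<beta>_def)
      ultimately show "\<alpha> ` B \<union> \<beta> ` C \<subseteq> UNIV \<times> {..<10}" by blast
    qed (use BC in auto)
    ultimately show "\<nexists>w. prod d B * prod n C = w\<^sup>2" by simp
  next
    fix j
    define b where "b = j div k"
    define R where "R = pell_relation (j mod k)"
    have R: "R \<subseteq> {..<r}" using rel[of "j mod k"] k by (simp add: R_def)
    have "prod d ((+) (r * b) ` R) = prod (g b) R"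
    proof (subst prod.reindex)
      show "prod (d \<circ> (+) (r * b)) R = prod (g b) R"
        using R r by (intro prod.cong) (auto simp: d_def \<alpha>_def)
    qed auto
    moreover have "n j = g b (3 + j mod k)" by (simp add: n_def \<beta>_def b_def)
    moreover obtain w where "g b (3 + j mod k) * (g b (3 + j mod k) - 1) * prod (g b) R = w\<^sup>2"
      using g(1)[of b] modk[of j] unfolding pell_block_def R_def by blast
    moreover have "(+) (r * b) ` R \<subseteq> {r * b..<r * b + r}" using R by auto
    ultimately show "\<exists>S\<subseteq>{r * (j div k)..<r * (j div k) + r}. \<exists>w. n j * (n j - 1) * prod d S = w\<^sup>2"
      unfolding b_def by metis
  qed (use r k t in auto)
qed

theorem theorem6p14:
  fixes t :: nat
  assumes "t \<ge> 1"
  shows "infinite {L. real_multiquadratic L \<and> gal L \<cong> elem2_group (2 * t) \<and>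
            (\<exists>u. (\<forall>i<3 * t. is_unit_of L (u i) \<and> totally_positive L (u i)) \<and>
                 indep_mod_squares L u (3 * t))}
       \<and> infinite {L. real_multiquadratic L \<and> gal L \<cong> elem2_group (3 * t) \<and>
            (\<exists>u. (\<forall>i<7 * t. is_unit_of L (u i) \<and> totally_positive L (u i)) \<and>
                 indep_mod_squares L u (7 * t))}"
proof
  show "infinite {L. real_multiquadratic L \<and> gal L \<cong> elem2_group (2 * t) \<and>
            (\<exists>u. (\<forall>i<3 * t. is_unit_of L (u i) \<and> totally_positive L (u i)) \<and>
                 indep_mod_squares L u (3 * t))}"
  proof (rule infinite_fields_from_blocks)
    fix j :: nat assume "j < 3"
    then have "j = 0 \<or> j = 1 \<or> j = 2" by auto
    then show "pell_relation j \<subseteq> {..<2}" by (auto simp: pell_relation_def)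
  qed (use assms in auto)
  show "infinite {L. real_multiquadratic L \<and> gal L \<cong> elem2_group (3 * t) \<and>
            (\<exists>u. (\<forall>i<7 * t. is_unit_of L (u i) \<and> totally_positive L (u i)) \<and>
                 indep_mod_squares L u (7 * t))}"
  proof (rule infinite_fields_from_blocks)
    fix j :: nat assume "j < 7"
    then have "j = 0 \<or> j = 1 \<or> j = 2 \<or> j = 3 \<or> j = 4 \<or> j = 5 \<or> j = 6" by auto
    then show "pell_relation j \<subseteq> {..<3}" by (auto simp: pell_relation_def)
  qed (use assms in auto)
qed

end
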